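(* Let $P$ be $\mathbb{R}^2$ equipped with the pencil diffeology, let $E_0(P)=I_0(P)/I_0(P)^2$ be its Zariski cotangent space at $0$, and let $J\colon E_0(P)\to\prod_{L\in\mathbb{RP}^1}L^*$, $[F]\mapsto(d_0(F|_L))_{L}$, be the linewise derivative map. Under the vector-space identification of $\prod_{L\in\mathbb{RP}^1}L^*$ with the space $\operatorname{Odd}(S^1)$ of odd functions $S^1\to\mathbb{R}$ (so that $J([F])$ corresponds to the function $v\mapsto\frac{d}{dt}\big|_{t=0}F(tv)$), one has the equality of vector subspaces of $\operatorname{Odd}(S^1)$ $$J(E_0(P))=\operatorname{Odd}_\sigma(S^1),$$ where $\operatorname{Odd}_\sigma(S^1)$ is the space of odd $\sigma$-continuous functions on $S^1$.
   Context: Diffeologies. A parametrization of a set $X$ is a map $U\to X$ with $U$ open in some $\mathbb{R}^n$, $n\ge0$. A diffeology on $X$ is a set of parametrizations, called plots, such that: every constant parametrization is a plot; a parametrization that is a plot on each member of some open cover of its domain is a plot; and the composite of a plot $U\to X$ with an ordinary smooth map $V\to U$ ($V\subset\mathbb{R}^m$ open) is a plot. A map $f\colon X\to Y$ of diffeological spaces is smooth if $f\circ p$ is a plot of $Y$ for every plot $p$ of $X$. The $D$-topology on $X$ is the finest topology making all plots continuous. Subset diffeology on $Y\subset X$: plots are parametrizations of $Y$ that are plots of $X$. Euclidean open sets carry their standard diffeology (plots are the ordinary smooth maps). Pencil diffeology. $P$ is the set $\mathbb{R}^2$ with the following plots: $p\colon U\to\mathbb{R}^2$ is a plot iff every $u_0\in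 U$ has an open neighborhood $V\subset U$ such that either (1) $p(u_0)\ne0$ and $p|_V$ is ordinary smooth, or (2) $p(u_0)=0$ and there is a line $L\subset\mathbb{R}^2$ through the origin such that $p(V)\subset L$ and $p|_V\colon V\to L$ is ordinary smooth. Germs. $G(P,0)=\operatorname{colim}_{0\in B}C^\infty(B,\mathbb{R})$ over $D$-open neighborhoods $B$ of $0$ in $P$ (with the subset diffeology) is the algebra of germs at $0$ of smooth functions; $I_0(P)=\{f\in G(P,0):f(0)=0\}$; $I_0(P)^2$ is the ideal of finite sums of products of two elements of $I_0(P)$. Linewise derivatives. $\mathbb{RP}^1$ is the set of lines through the origin in $\mathbb{R}^2$; $L^*$ is the dual of $L$; $d_0(F|_L)\in L^*$ is the ordinary derivative at $0$ of $F|_L$. The map $J$ is well defined, since $d_0(f|_L)=0$ for $f\in I_0(P)^2$. Identification. A family $s=(s_L)_{L}\in\prod_L L^*$ corresponds to the odd function $\hat s(v)=s_{\mathbb{R}v}(v)$ on $S^1$; conversely an odd $h\colon S^1\to\mathbb{R}$ corresponds to the family $s^h_L(tv)=t\,h(v)$ ($v\in S^1\cap L$, $t\in\mathbb{R}$). These are inverse linear bijections. $\sigma$-continuity. $h\colon S^1\to\mathbb{R}$ is $\sigma$-continuous if there is a sequence $(C_n)_{n\in\mathbb{N}}$ of closed subsets of $S^1$ with $S^1=\bigcup_n C_n$ and $h|_{C_n}$ continuous for every $n$. *)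

theory Defs
  imports "HOL-Analysis.Analysis" "HOL-Algebra.Ideal_Product"
begin

section \<open>Smooth maps on open subsets of Euclidean spaces\<close>

text \<open>
  The dimension n of the domain of a plot varies inside the definition of a diffeology, so
  n-space is the topology \<^term>\<open>Euclidean_space n\<close>, whose points are the functions
  x with \<^prop>\<open>\<forall>i\<ge>n. x i = (0::real)\<close>.
\<close>

definition pderiv_at :: "nat \<Rightarrow> ((nat \<Rightarrow> real) \<Rightarrow> 'b::real_normed_vector) \<Rightarrow> (nat \<Rightarrow> real) \<Rightarrow> 'b" where
  "pderiv_at i f x = vector_derivative (\<lambda>t. f (x(i := t))) (at (x i))"

text \<open>
  Smoothness on an open set: all iterated partial derivatives (indexed by lists of coordinate
  numbers below n) exist and are continuous.  Only the values of f on U matter, since U is open.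
\<close>

definition smooth_on :: "nat \<Rightarrow> (nat \<Rightarrow> real) set \<Rightarrow> ((nat \<Rightarrow> real) \<Rightarrow> 'b::real_normed_vector) \<Rightarrow> bool" where
  "smooth_on n U f \<longleftrightarrow>
     (\<forall>is. set is \<subseteq> {..<n} \<longrightarrow>
        continuous_map (subtopology (Euclidean_space n) U) euclidean (foldr pderiv_at is f) \<and>
        (\<forall>x\<in>U. \<forall>i<n. (\<lambda>t. foldr pderiv_at is f (x(i := t))) differentiable (at (x i))))"


section \<open>Diffeological spaces\<close>

text \<open>
  D n U p says that p, restricted to the open set U of n-space, is a plot.
\<close>

type_synonym 'a plots = "nat \<Rightarrow> (nat \<Rightarrow> real) set \<Rightarrow> ((nat \<Rightarrow> real) \<Rightarrow> 'a) \<Rightarrow> bool"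

text \<open>
  Since parametrizations are total functions here, the second clause expresses that being a plot
  depends on the values on U only.
\<close>

definition diffeology_on :: "'a set \<Rightarrow> 'a plots \<Rightarrow> bool" where
  "diffeology_on X D \<longleftrightarrow>
     (\<forall>n U p. D n U p \<longrightarrow> openin (Euclidean_space n) U \<and> p ` U \<subseteq> X) \<and>
     (\<forall>n U p q. D n U p \<and> (\<forall>u\<in>U. q u = p u) \<longrightarrow> D n U q) \<and>
     (\<forall>n U x. openin (Euclidean_space n) U \<and> x \<in> X \<longrightarrow> D n U (\<lambda>_. x)) \<and>
     (\<forall>n \<U> p. (\<forall>U\<in>\<U>. openin (Euclidean_space n) U \<and> D n U p) \<longrightarrow> D n (\<Union>\<U>) p) \<and>
     (\<forall>n U p m V g. D n U p \<and> openin (Euclidean_space m) V \<and> g ` V \<subseteq> U \<and>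
        (\<forall>i<n. smooth_on m V (\<lambda>x. g x i)) \<longrightarrow> D m V (p \<circ> g))"

definition subset_diffeology :: "'a plots \<Rightarrow> 'a set \<Rightarrow> 'a plots" where
  "subset_diffeology D Y n U p \<longleftrightarrow> D n U p \<and> p ` U \<subseteq> Y"

definition standard_diffeology :: "'b::euclidean_space plots" where
  "standard_diffeology n U p \<longleftrightarrow> openin (Euclidean_space n) U \<and> smooth_on n U p"

definition diff_smooth :: "'a set \<Rightarrow> 'a plots \<Rightarrow> 'b set \<Rightarrow> 'b plots \<Rightarrow> ('a \<Rightarrow> 'b) \<Rightarrow> bool" where
  "diff_smooth X D Y E f \<longleftrightarrow> f ` X \<subseteq> Y \<and> (\<forall>n U p. D n U p \<longrightarrow> E n U (f \<circ> p))"

definition D_topology :: "'a set \<Rightarrow> 'a plots \<Rightarrow> 'a topology" where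
  "D_topology X D = topology (\<lambda>A. A \<subseteq> X \<and>
     (\<forall>n U p. D n U p \<longrightarrow> openin (subtopology (Euclidean_space n) U) {u\<in>U. p u \<in> A}))"

lemma openin_D_topology:
  assumes "\<And>n U p. D n U p \<Longrightarrow> openin (Euclidean_space n) U"
  shows "openin (D_topology X D) A \<longleftrightarrow> A \<subseteq> X \<and>
     (\<forall>n U p. D n U p \<longrightarrow> openin (subtopology (Euclidean_space n) U) {u\<in>U. p u \<in> A})"
proof -
  have "istopology (\<lambda>A. A \<subseteq> X \<and>
     (\<forall>n U p. D n U p \<longrightarrow> openin (subtopology (Euclidean_space n) U) {u\<in>U. p u \<in> A}))"
    unfolding istopology_def
  proof (intro conjI allI impI)
    fix S T n U p
    assume S: "S \<subseteq> X \<and> (\<forall>n U p. D n U p \<longrightarrow> openin (subtopology (Euclidean_space n) U) {u\<in>U. p u \<in> S})"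
      and T: "T \<subseteq> X \<and> (\<forall>n U p. D n U p \<longrightarrow> openin (subtopology (Euclidean_space n) U) {u\<in>U. p u \<in> T})"
      and D: "D n U p"
    have "{u\<in>U. p u \<in> S \<inter> T} = {u\<in>U. p u \<in> S} \<inter> {u\<in>U. p u \<in> T}" by auto
    then show "openin (subtopology (Euclidean_space n) U) {u\<in>U. p u \<in> S \<inter> T}"
      using S T D by (simp add: openin_Int)
  next
    fix \<K> n U p
    assume K: "\<forall>K\<in>\<K>. K \<subseteq> X \<and> (\<forall>n U p. D n U p \<longrightarrow> openin (subtopology (Euclidean_space n) U) {u\<in>U. p u \<in> K})"
      and D: "D n U p"
    have "{u\<in>U. p u \<in> \<Union>\<K>} = \<Union>((\<lambda>K. {u\<in>U. p u \<in> K}) ` \<K>)" by auto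
    moreover have "openin (subtopology (Euclidean_space n) U) (\<Union>((\<lambda>K. {u\<in>U. p u \<in> K}) ` \<K>))"
      using K D by (intro openin_Union) blast
    ultimately show "openin (subtopology (Euclidean_space n) U) {u\<in>U. p u \<in> \<Union>\<K>}" by simp
  qed auto
  then show ?thesis by (simp add: D_topology_def topology_inverse')
qed

lemma topspace_D_topology:
  assumes "\<And>n U p. D n U p \<Longrightarrow> openin (Euclidean_space n) U \<and> p ` U \<subseteq> X"
  shows "topspace (D_topology X D) = X"
proof
  show "topspace (D_topology X D) \<subseteq> X"
    using assms openin_D_topology[of D X "topspace (D_topology X D)"] by auto
  have "openin (subtopology (Euclidean_space n) U) {u\<in>U. p u \<in> X}" if "D n U p" for n U p
  proof -
    have "{u\<in>U. p u \<in> X} = U" using assms[OF that] by auto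
    then show ?thesis
      using assms[OF that] openin_subset[of "Euclidean_space n" U] by (simp add: openin_subtopology_refl)
  qed
  then have "openin (D_topology X D) X"
    using assms openin_D_topology[of D X X] by blast
  then show "X \<subseteq> topspace (D_topology X D)" by (rule openin_subset)
qed

lemma D_topology_finest:
  assumes D: "\<And>n U p. D n U p \<Longrightarrow> openin (Euclidean_space n) U \<and> p ` U \<subseteq> X"
  shows "D n U p \<Longrightarrow> continuous_map (subtopology (Euclidean_space n) U) (D_topology X D) p"
    and "\<lbrakk>topspace T = X;
          \<And>n U p. D n U p \<Longrightarrow> continuous_map (subtopology (Euclidean_space n) U) T p;
          openin T A\<rbrakk> \<Longrightarrow> openin (D_topology X D) A"
proof -
  have ts: "topspace (subtopology (Euclidean_space n) U) = U" if "D n U p" for n U p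
    using D[OF that] openin_subset[of "Euclidean_space n" U] by auto
  show "continuous_map (subtopology (Euclidean_space n) U) (D_topology X D) p" if "D n U p"
    unfolding continuous_map_def ts[OF that]
  proof (intro conjI allI impI)
    show "p \<in> U \<rightarrow> topspace (D_topology X D)"
      using D that topspace_D_topology[of D X] by blast
    show "openin (subtopology (Euclidean_space n) U) {x \<in> U. p x \<in> W}"
      if "openin (D_topology X D) W" for W
      using that \<open>D n U p\<close> openin_D_topology[of D X W] D by blast
  qed
  show "openin (D_topology X D) A"
    if "topspace T = X" "\<And>n U p. D n U p \<Longrightarrow> continuous_map (subtopology (Euclidean_space n) U) T p"
      "openin T A"
  proof (subst openin_D_topology, use D in blast, intro conjI allI impI)
    show "A \<subseteq> X" using that openin_subset by blast
    show "openin (subtopology (Euclidean_space n) U) {u\<in>U. p u \<in> A}" if "D n U p" for n U p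
      using that \<open>\<And>n U p. D n U p \<Longrightarrow> continuous_map _ T p\<close>[OF that] \<open>openin T A\<close>
      unfolding continuous_map_def ts[OF that] by blast
  qed
qed

lemma diffeology_on_subset:
  assumes X: "diffeology_on X D" and Y: "Y \<subseteq> X"
  shows "diffeology_on Y (subset_diffeology D Y)"
proof -
  note X = X[unfolded diffeology_on_def]
  note 1 = X[THEN conjunct1, rule_format]
  note 2 = X[THEN conjunct2, THEN conjunct1, rule_format]
  note 3 = X[THEN conjunct2, THEN conjunct2, THEN conjunct1, rule_format]
  note 4 = X[THEN conjunct2, THEN conjunct2, THEN conjunct2, THEN conjunct1, rule_format]
  note 5 = X[THEN conjunct2, THEN conjunct2, THEN conjunct2, THEN conjunct2, rule_format]
  show ?thesis
    unfolding diffeology_on_def subset_diffeology_def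
  proof (intro conjI allI impI; (elim conjE)?)
    show "D n U q" if "\<forall>u\<in>U. q u = p u" "D n U p" for n U p q
      using 2[of n U p q] that by simp
    show "q ` U \<subseteq> Y" if "\<forall>u\<in>U. q u = p u" "p ` U \<subseteq> Y" for U and p q :: "(nat \<Rightarrow> real) \<Rightarrow> 'a"
      using that by auto
    show "D m V (p \<circ> g)"
      if "D n U p" "openin (Euclidean_space m) V" "g ` V \<subseteq> U" "\<forall>i<n. smooth_on m V (\<lambda>x. g x i)"
      for n U p m V g
      using 5[of n U p m V g] that by simp
    show "D n (\<Union>\<U>) p" if "\<forall>U\<in>\<U>. openin (Euclidean_space n) U \<and> D n U p \<and> p ` U \<subseteq> Y" for n \<U> p
      using 4[of \<U> n p] that by simp
  qed (use 1 3 Y in auto)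
qed


section \<open>Germs and the Zariski cotangent space\<close>

definition D_nbhds :: "'a set \<Rightarrow> 'a plots \<Rightarrow> 'a \<Rightarrow> 'a set set" where
  "D_nbhds X D x = {B. openin (D_topology X D) B \<and> x \<in> B}"

definition smooth_functions :: "'a plots \<Rightarrow> 'a set \<Rightarrow> ('a \<Rightarrow> real) set" where
  "smooth_functions D B =
     {f \<in> extensional B. diff_smooth B (subset_diffeology D B) UNIV standard_diffeology f}"

definition local_functions :: "'a set \<Rightarrow> 'a plots \<Rightarrow> 'a \<Rightarrow> ('a set \<times> ('a \<Rightarrow> real)) set" where
  "local_functions X D x = (SIGMA B : D_nbhds X D x. smooth_functions D B)"

definition germ_rel ::
  "'a set \<Rightarrow> 'a plots \<Rightarrow> 'a \<Rightarrow> (('a set \<times> ('a \<Rightarrow> real)) \<times> ('a set \<times> ('a \<Rightarrow> real))) set" where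
  "germ_rel X D x = {((B, f), (B', g)).
     (B, f) \<in> local_functions X D x \<and> (B', g) \<in> local_functions X D x \<and>
     (\<exists>W \<in> D_nbhds X D x. W \<subseteq> B \<inter> B' \<and> (\<forall>y\<in>W. f y = g y))}"

type_synonym 'a germ = "('a set \<times> ('a \<Rightarrow> real)) set"

definition germ_of :: "'a set \<Rightarrow> 'a plots \<Rightarrow> 'a \<Rightarrow> 'a set \<Rightarrow> ('a \<Rightarrow> real) \<Rightarrow> 'a germ" where
  "germ_of X D x B f = germ_rel X D x `` {(B, restrict f B)}"

definition germ_op ::
  "'a set \<Rightarrow> 'a plots \<Rightarrow> 'a \<Rightarrow> (real \<Rightarrow> real \<Rightarrow> real) \<Rightarrow> 'a germ \<Rightarrow> 'a germ \<Rightarrow> 'a germ" where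
  "germ_op X D x h a b =
     the_elem {germ_of X D x (B \<inter> B') (\<lambda>y. h (f y) (g y)) | B f B' g. (B, f) \<in> a \<and> (B', g) \<in> b}"

definition germ_ring :: "'a set \<Rightarrow> 'a plots \<Rightarrow> 'a \<Rightarrow> 'a germ ring" where
  "germ_ring X D x =
     \<lparr> carrier = local_functions X D x // germ_rel X D x,
       mult = germ_op X D x (*),
       one = germ_of X D x X (\<lambda>_. 1),
       zero = germ_of X D x X (\<lambda>_. 0),
       add = germ_op X D x (+) \<rparr>"

definition germ_value :: "'a \<Rightarrow> 'a germ \<Rightarrow> real" where
  "germ_value x a = the_elem ((\<lambda>(B, f). f x) ` a)"

definition germ_ideal :: "'a set \<Rightarrow> 'a plots \<Rightarrow> 'a \<Rightarrow> 'a germ set" where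
  "germ_ideal X D x = {a \<in> carrier (germ_ring X D x). germ_value x a = 0}"

definition germ_ideal_sq :: "'a set \<Rightarrow> 'a plots \<Rightarrow> 'a \<Rightarrow> 'a germ set" where
  "germ_ideal_sq X D x = ideal_prod (germ_ring X D x) (germ_ideal X D x) (germ_ideal X D x)"

definition cot_class :: "'a set \<Rightarrow> 'a plots \<Rightarrow> 'a \<Rightarrow> 'a germ \<Rightarrow> 'a germ set" where
  "cot_class X D x a = germ_ideal_sq X D x +>\<^bsub>germ_ring X D x\<^esub> a"

definition cotangent_space :: "'a set \<Rightarrow> 'a plots \<Rightarrow> 'a \<Rightarrow> 'a germ set set" where
  "cotangent_space X D x = cot_class X D x ` germ_ideal X D x"


section \<open>The pencil diffeology and the linewise derivative\<close>

definition lines :: "(real^2) set set" where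
  "lines = {L. subspace L \<and> dim L = 1}"

text \<open>
  A map into a line L is smooth iff it is smooth as a map into the plane and takes values in L.
\<close>

definition pencil :: "(real^2) plots" where
  "pencil n U p \<longleftrightarrow> openin (Euclidean_space n) U \<and>
     (\<forall>u\<^sub>0\<in>U. \<exists>V. openin (Euclidean_space n) V \<and> u\<^sub>0 \<in> V \<and> V \<subseteq> U \<and>
        ((p u\<^sub>0 \<noteq> 0 \<and> smooth_on n V p) \<or>
         (p u\<^sub>0 = 0 \<and> (\<exists>L\<in>lines. p ` V \<subseteq> L \<and> smooth_on n V p))))"

abbreviation "E\<^sub>0_pencil \<equiv> cotangent_space UNIV pencil (0 :: real^2)"

definition dual_space :: "(real^2) set \<Rightarrow> (real^2 \<Rightarrow> real) set" where
  "dual_space L = {\<phi> \<in> extensional L.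
     (\<forall>x\<in>L. \<forall>y\<in>L. \<phi> (x + y) = \<phi> x + \<phi> y) \<and> (\<forall>x\<in>L. \<forall>c. \<phi> (c *\<^sub>R x) = c * \<phi> x)}"

text \<open>
  The derivative within L is unique as a functional on L only, hence the restriction to L.
\<close>

definition line_deriv :: "(real^2 \<Rightarrow> real) \<Rightarrow> (real^2) set \<Rightarrow> real^2 \<Rightarrow> real" where
  "line_deriv F L = restrict (frechet_derivative F (at 0 within L)) L"

text \<open>
  An element c of the cotangent space is a coset of germs, so \<^term>\<open>\<Union>c\<close> is the set of all its
  representatives (B, F).
\<close>

definition linewise_derivative :: "(real^2) germ set \<Rightarrow> (real^2) set \<Rightarrow> real^2 \<Rightarrow> real" where
  "linewise_derivative c = the_elem ((\<lambda>(B, F). \<lambda>L\<in>lines. line_deriv F L) ` \<Union>c)"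


section \<open>Odd functions on the circle\<close>

abbreviation circle :: "(real^2) set" where
  "circle \<equiv> sphere 0 1"

definition Odd :: "(real^2 \<Rightarrow> real) set" where
  "Odd = {h \<in> extensional circle. \<forall>v\<in>circle. h (- v) = - h v}"

definition sigma_continuous :: "(real^2 \<Rightarrow> real) \<Rightarrow> bool" where
  "sigma_continuous h \<longleftrightarrow>
     (\<exists>C :: nat \<Rightarrow> (real^2) set. (\<forall>n. closedin (top_of_set circle) (C n)) \<and>
        circle = (\<Union>n. C n) \<and> (\<forall>n. continuous_on (C n) h))"

definition Odd_sigma :: "(real^2 \<Rightarrow> real) set" where
  "Odd_sigma = {h \<in> Odd. sigma_continuous h}"

definition odd_of_family :: "((real^2) set \<Rightarrow> real^2 \<Rightarrow> real) \<Rightarrow> real^2 \<Rightarrow> real" where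
  "odd_of_family s = (\<lambda>v\<in>circle. s (span {v}) v)"

text \<open>
  The lemma bij_betw_odd_of_family below shows that this identification is a bijection from the
  product of the duals onto the odd functions; odd_of_family_inverse gives its inverse.
\<close>

lemma span_in_lines: "v \<noteq> 0 \<Longrightarrow> span {v} \<in> lines"
  by (simp add: lines_def)

lemma line_eq_span:
  assumes "L \<in> lines" "v \<in> L" "v \<noteq> 0"
  shows "L = span {v}"
proof -
  have "subspace L" "dim L = 1" using assms by (auto simp: lines_def)
  moreover have "span {v} \<subseteq> L" using assms(2) \<open>subspace L\<close> by (simp add: span_minimal)
  moreover have "dim (span {v}) = 1" using assms(3) by simp
  ultimately show ?thesis using subspace_dim_equal[of "span {v}" L] by simp
qed

lemma line_unit_vector:
  assumes "L \<in> lines"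
  obtains v where "v \<in> L \<inter> circle"
proof -
  have L: "subspace L" "dim L = 1" using assms by (auto simp: lines_def)
  then obtain w where w: "w \<in> L" "w \<noteq> 0" by (metis dim_eq_0 subset_singletonD subset_iff singletonI zero_neq_one)
  have "w /\<^sub>R norm w \<in> L \<inter> circle" using w L by (simp add: subspace_scale)
  then show ?thesis using that by blast
qed

lemma odd_of_family_inverse:
  assumes "s \<in> PiE lines dual_space" "L \<in> lines" "v \<in> L \<inter> circle"
  shows "s L (t *\<^sub>R v) = t * odd_of_family s v"
proof -
  have "v \<noteq> 0" using assms(3) by auto
  then have "L = span {v}" using line_eq_span assms by blast
  moreover have "s L \<in> dual_space L" using assms by auto
  ultimately show ?thesis using assms(3) by (auto simp: dual_space_def odd_of_family_def)
qed

lemma bij_betw_odd_of_family: "bij_betw odd_of_family (PiE lines dual_space) Odd"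
  unfolding bij_betw_def
proof
  show "inj_on odd_of_family (PiE lines dual_space)"
  proof (rule inj_onI)
    fix r s assume r: "r \<in> PiE lines dual_space" and s: "s \<in> PiE lines dual_space"
      and eq: "odd_of_family r = odd_of_family s"
    show "r = s"
    proof (rule PiE_ext[OF r s])
      fix L assume L: "L \<in> lines"
      obtain v where v: "v \<in> L \<inter> circle" using line_unit_vector[OF L] .
      then have Lv: "L = span {v}" using line_eq_span[OF L] by force
      have "r L \<in> extensional L" "s L \<in> extensional L"
        using r s L by (auto simp: dual_space_def)
      then show "r L = s L"
      proof (rule extensionalityI)
        fix w assume "w \<in> L"
        then obtain t where "w = t *\<^sub>R v" using Lv by (auto simp: span_singleton)
        then show "r L w = s L w"
          using odd_of_family_inverse[OF r L v] odd_of_family_inverse[OF s L v] eq by simp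
      qed
    qed
  qed
  show "odd_of_family ` (PiE lines dual_space) = Odd"
  proof
    show "odd_of_family ` (PiE lines dual_space) \<subseteq> Odd"
    proof
      fix h assume "h \<in> odd_of_family ` (PiE lines dual_space)"
      then obtain s where s: "s \<in> PiE lines dual_space" and h: "h = odd_of_family s" by blast
      have "h (- v) = - h v" if v: "v \<in> circle" for v
      proof -
        have nz: "v \<noteq> 0" using v by auto
        have "span {- v} = span {v}"
          using nz by (intro line_eq_span[symmetric] span_in_lines) (auto simp: span_neg span_base)
        then have "h (- v) = s (span {v}) ((- 1) *\<^sub>R v)" using v by (simp add: h odd_of_family_def)
        also have "\<dots> = - h v"
          using odd_of_family_inverse[OF s span_in_lines[OF nz], of v "- 1"] v
          by (simp add: h span_base)
        finally show ?thesis .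
      qed
      moreover have "h \<in> extensional circle" by (simp add: h odd_of_family_def)
      ultimately show "h \<in> Odd" by (simp add: Odd_def)
    qed
    show "Odd \<subseteq> odd_of_family ` (PiE lines dual_space)"
    proof
      fix h assume h: "h \<in> Odd"
      define u where "u L = (SOME v. v \<in> L \<inter> circle)" for L
      have u: "u L \<in> L \<inter> circle" if "L \<in> lines" for L
        using line_unit_vector[OF that] unfolding u_def by (metis someI)
      define s where "s = (\<lambda>L\<in>lines. \<lambda>w\<in>L. (w \<bullet> u L) * h (u L))"
      have "s \<in> PiE lines dual_space"
      proof (rule PiE_I)
        fix L assume L: "L \<in> lines"
        then have "subspace L" by (simp add: lines_def)
        then show "s L \<in> dual_space L"
          using L by (auto simp: s_def dual_space_def inner_add_left algebra_simps subspace_add subspace_scale)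
      qed (simp add: s_def)
      moreover have "odd_of_family s = h"
      proof (rule extensionalityI[where A=circle])
        fix v assume v: "v \<in> circle"
        then have nz: "v \<noteq> 0" by auto
        let ?L = "span {v}"
        have L: "?L \<in> lines" using nz by (rule span_in_lines)
        obtain t where t: "u ?L = t *\<^sub>R v" using u[OF L] by (auto simp: span_singleton)
        then have "\<bar>t\<bar> = 1" using u[OF L] v by simp
        then have "t = 1 \<or> t = - 1" by linarith
        moreover have "v \<bullet> v = 1" using v by (simp add: dot_square_norm)
        ultimately show "odd_of_family s v = h v"
          using h v L t by (auto simp: odd_of_family_def s_def Odd_def span_base)
      qed (use h in \<open>auto simp: odd_of_family_def Odd_def\<close>)
      ultimately show "h \<in> odd_of_family ` (PiE lines dual_space)" by blast
    qed
  qed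
qed

end

theory Submission
  imports Defs
begin

text \<open>
  A function on a neighbourhood of 0 in the pencil plane is smooth iff it is smooth in the ordinary
  sense away from 0 and smooth along every line through 0.  Elements of \<open>I\<^sub>0\<^sup>2\<close> have zero linewise
  derivatives by the Leibniz rule, so the odd function attached to the class of F is
  \<open>h(v) = d/dt F(tv)\<close> at \<open>t = 0\<close>.  The question is which odd functions h on the circle are of this
  form.

  Necessity of sigma-continuity.  Since F is twice differentiable along each line, the difference
  quotients \<open>F(tv) / t\<close> converge to \<open>h(v)\<close> with a linear rate.  The directions with rate k on the
  time window of length 1/k form a closed set, because F is continuous away from 0; on this set the
  convergence is uniform, so h is continuous there, and the sets exhaust the circle
  (\<open>sigma_continuous_directional_derivative\<close>).

  Sufficiency.  If the circle is the increasing union of symmetric compact sets \<open>K\<^sub>n\<close> on which h is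
  continuous, the Weierstrass theorem gives odd polynomials that approximate h on \<open>K\<^sub>n\<close> up to
  \<open>1/(n+1)!\<close>.  Their successive differences \<open>d\<^sub>n\<close> satisfy \<open>\<Sum>d\<^sub>n(v) = h(v)\<close>, with factorially
  small terms from an index on that depends on v (\<open>Odd_sigma_polynomial_series\<close>).  With a smooth odd
  function b supported in [-1, 1] and with \<open>b'(0) = 1\<close>, put
  \<open>F(x) = \<Sum> d\<^sub>n(x / |x|) 2\<^sup>-\<^sup>n b(2\<^sup>n |x|)\<close>.  Near a nonzero point only finitely many terms are nonzero,
  so F is smooth there.  On the line through v it equals \<open>\<Sum> d\<^sub>n(v) 2\<^sup>-\<^sup>n b(2\<^sup>n t)\<close>, which may be
  differentiated termwise arbitrarily often since \<open>1/n!\<close> beats every \<open>2\<^sup>k\<^sup>n\<close>, and has derivative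
  \<open>\<Sum>d\<^sub>n(v) = h(v)\<close> at 0 (\<open>bump_series_smooth_functions\<close>, \<open>bump_series_smooth_on_lines\<close>).

  Smoothness itself, defined by iterated partial derivatives, is handled by coinduction: a set of
  continuous functions closed under partial differentiation consists of smooth functions
  (\<open>smooth_on_coinduct\<close>).
\<close>

section \<open>A calculus of smooth maps\<close>

lemma continuous_map_fun_upd_Euclidean:
  assumes "x \<in> topspace (Euclidean_space n)" "i < n"
  shows "continuous_map euclideanreal (Euclidean_space n) (\<lambda>t. x(i := t))"
proof -
  have "continuous_map euclideanreal (Euclidean_space n) (\<lambda>t j. if j < n then (x(i := t)) j else 0)"
    unfolding continuous_map_componentwise_Euclidean_space
    by (auto simp: fun_upd_def intro!: continuous_intros)
  moreover have "(\<lambda>t j. if j < n then (x(i := t)) j else 0) = (\<lambda>t. x(i := t))"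
    using assms by (fastforce simp: topspace_Euclidean_space)
  ultimately show ?thesis by simp
qed

lemma eventually_fun_upd_in_open:
  assumes U: "openin (Euclidean_space n) U" and "x \<in> U" "i < n"
  shows "eventually (\<lambda>t. x(i := t) \<in> U) (nhds (x i))"
proof -
  have "x \<in> topspace (Euclidean_space n)" using assms openin_subset by blast
  then have "openin euclideanreal {t \<in> topspace euclideanreal. x(i := t) \<in> U}"
    using assms by (intro openin_continuous_map_preimage[OF continuous_map_fun_upd_Euclidean])
  then have "open {t. x(i := t) \<in> U}" by simp
  then show ?thesis using \<open>x \<in> U\<close> by (auto simp: eventually_nhds)
qed

lemma has_vector_derivative_fun_upd_cong:
  assumes U: "openin (Euclidean_space n) U" and "x \<in> U" "i < n" and eq: "\<And>y. y \<in> U \<Longrightarrow> f y = g y"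
  shows "((\<lambda>t. f (x(i := t))) has_vector_derivative d) (at (x i)) \<longleftrightarrow>
         ((\<lambda>t. g (x(i := t))) has_vector_derivative d) (at (x i))"
proof (rule has_vector_derivative_cong_ev)
  show "\<forall>\<^sub>F t in nhds (x i). t \<in> UNIV \<longrightarrow> f (x(i := t)) = g (x(i := t))"
    using eventually_fun_upd_in_open[OF assms(1-3)] by eventually_elim (simp add: eq)
qed (use assms in simp_all)

text \<open>
  The principle by which all smoothness below is proved: a set of continuous functions that is
  closed under partial differentiation, up to equality on the open set, consists of smooth functions.
\<close>

lemma smooth_on_coinduct:
  fixes f :: "(nat \<Rightarrow> real) \<Rightarrow> 'b::real_normed_vector"
  assumes U: "openin (Euclidean_space n) U" and f: "f \<in> \<F>"
    and cont: "\<And>g. g \<in> \<F> \<Longrightarrow> continuous_map (subtopology (Euclidean_space n) U) euclidean g"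
    and der: "\<And>g i. g \<in> \<F> \<Longrightarrow> i < n \<Longrightarrow>
      \<exists>g'\<in>\<F>. \<forall>x\<in>U. ((\<lambda>t. g (x(i := t))) has_vector_derivative g' x) (at (x i))"
  shows "smooth_on n U f"
proof -
  have iter: "\<exists>g\<in>\<F>. \<forall>x\<in>U. foldr pderiv_at is f x = g x" if "set is \<subseteq> {..<n}" for "is"
    using that
  proof (induction "is")
    case Nil
    then show ?case using f by auto
  next
    case (Cons i "is")
    then obtain g where g: "g \<in> \<F>" "\<And>x. x \<in> U \<Longrightarrow> foldr pderiv_at is f x = g x" by auto
    have i: "i < n" using Cons by simp
    obtain g' where g': "g' \<in> \<F>"
      "\<And>x. x \<in> U \<Longrightarrow> ((\<lambda>t. g (x(i := t))) has_vector_derivative g' x) (at (x i))"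
      using der[OF g(1) i] by blast
    have "foldr pderiv_at (i # is) f x = g' x" if "x \<in> U" for x
      using g'(2)[OF that] has_vector_derivative_fun_upd_cong[OF U that i, of "foldr pderiv_at is f" g] g(2)
      by (simp add: pderiv_at_def vector_derivative_at)
    then show ?case using g'(1) by auto
  qed
  show ?thesis
    unfolding smooth_on_def
  proof (intro allI impI conjI ballI)
    fix "is" assume "set is \<subseteq> {..<n}"
    then obtain g where g: "g \<in> \<F>" "\<And>x. x \<in> U \<Longrightarrow> foldr pderiv_at is f x = g x" using iter by blast
    show "continuous_map (subtopology (Euclidean_space n) U) euclidean (foldr pderiv_at is f)"
      by (rule continuous_map_eq[OF cont[OF g(1)]]) (simp add: g(2))
    fix x i assume x: "x \<in> U" and i: "i < n"
    obtain d where "((\<lambda>t. g (x(i := t))) has_vector_derivative d) (at (x i))"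
      using der[OF g(1) i] x by blast
    then have "((\<lambda>t. foldr pderiv_at is f (x(i := t))) has_vector_derivative d) (at (x i))"
      using has_vector_derivative_fun_upd_cong[OF U x i, of "foldr pderiv_at is f" g] g(2) by simp
    then show "(\<lambda>t. foldr pderiv_at is f (x(i := t))) differentiable (at (x i))"
      using differentiableI_vector by blast
  qed
qed

lemma smooth_on_continuous_map:
  "smooth_on n U f \<Longrightarrow> continuous_map (subtopology (Euclidean_space n) U) euclidean f"
  unfolding smooth_on_def by (drule spec[of _ "[]"]) simp

lemma smooth_on_pderiv_at:
  assumes "smooth_on n U f" "i < n"
  shows "smooth_on n U (pderiv_at i f)"
  unfolding smooth_on_def
proof (rule allI, rule impI)
  fix "is" assume "set is \<subseteq> {..<n}"
  then have "set (is @ [i]) \<subseteq> {..<n}" using assms(2) by simp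
  note assms(1)[unfolded smooth_on_def, rule_format, OF this]
  then show "continuous_map (subtopology (Euclidean_space n) U) euclidean (foldr pderiv_at is (pderiv_at i f)) \<and>
    (\<forall>x\<in>U. \<forall>j<n. (\<lambda>t. foldr pderiv_at is (pderiv_at i f) (x(j := t))) differentiable at (x j))"
    by simp
qed

lemma smooth_on_has_vector_derivative:
  assumes "smooth_on n U f" "i < n" "x \<in> U"
  shows "((\<lambda>t. f (x(i := t))) has_vector_derivative pderiv_at i f x) (at (x i))"
proof -
  have "(\<lambda>t. f (x(i := t))) differentiable (at (x i))"
    using assms(1)[unfolded smooth_on_def, rule_format, of "[]"] assms(2,3) by simp
  then show ?thesis unfolding pderiv_at_def by (simp add: vector_derivative_works)
qed

lemma smooth_on_cong:
  assumes U: "openin (Euclidean_space n) U" and f: "smooth_on n U f" and eq: "\<And>x. x \<in> U \<Longrightarrow> f x = g x"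
  shows "smooth_on n U g"
proof (rule smooth_on_coinduct[OF U, where \<F> = "{g. \<exists>f. smooth_on n U f \<and> (\<forall>x\<in>U. f x = g x)}"])
  show "g \<in> {g. \<exists>f. smooth_on n U f \<and> (\<forall>x\<in>U. f x = g x)}" using f eq by auto
next
  fix g assume "g \<in> {g. \<exists>f. smooth_on n U f \<and> (\<forall>x\<in>U. f x = g x)}"
  then obtain f where f: "smooth_on n U f" "\<And>x. x \<in> U \<Longrightarrow> f x = g x" by blast
  show "continuous_map (subtopology (Euclidean_space n) U) euclidean g"
    by (rule continuous_map_eq[OF smooth_on_continuous_map[OF f(1)]]) (simp add: f(2))
  fix i assume i: "i < n"
  show "\<exists>g'\<in>{g. \<exists>f. smooth_on n U f \<and> (\<forall>x\<in>U. f x = g x)}.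
    \<forall>x\<in>U. ((\<lambda>t. g (x(i := t))) has_vector_derivative g' x) (at (x i))"
    using smooth_on_pderiv_at[OF f(1) i] smooth_on_has_vector_derivative[OF f(1) i]
      has_vector_derivative_fun_upd_cong[OF U _ i, of _ f g] f(2)
    by (intro bexI[of _ "pderiv_at i f"]) auto
qed

lemma smooth_on_subset:
  assumes f: "smooth_on n U f" and V: "V \<subseteq> U"
  shows "smooth_on n V f"
  using assms unfolding smooth_on_def
  by (meson continuous_map_from_subtopology_mono subsetD)

lemma smooth_on_local:
  assumes U: "openin (Euclidean_space n) U"
    and loc: "\<And>u. u \<in> U \<Longrightarrow> \<exists>V. openin (Euclidean_space n) V \<and> u \<in> V \<and> V \<subseteq> U \<and> smooth_on n V f"
  shows "smooth_on n U f"
  unfolding smooth_on_def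
proof (intro allI impI conjI ballI)
  fix "is" assume is': "set is \<subseteq> {..<n}"
  obtain V where V: "\<And>u. u \<in> U \<Longrightarrow> openin (Euclidean_space n) (V u) \<and> u \<in> V u \<and> V u \<subseteq> U \<and> smooth_on n (V u) f"
    using loc by metis
  have ts: "topspace (subtopology (Euclidean_space n) U) = U" using openin_subset[OF U] by auto
  show "continuous_map (subtopology (Euclidean_space n) U) euclidean (foldr pderiv_at is f)"
  proof (rule pasting_lemma[where I = U and T = V and f = "\<lambda>_. foldr pderiv_at is f"])
    fix u assume u: "u \<in> U"
    show "openin (subtopology (Euclidean_space n) U) (V u)"
      using V[OF u] U by (simp add: openin_open_subtopology)
    have "U \<inter> V u = V u" using V[OF u] by auto
    then show "continuous_map (subtopology (subtopology (Euclidean_space n) U) (V u)) euclidean (foldr pderiv_at is f)"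
      using V[OF u] is' by (simp add: subtopology_subtopology smooth_on_def)
  qed (use V in \<open>auto simp: ts\<close>)
  show "(\<lambda>t. foldr pderiv_at is f (x(i := t))) differentiable at (x i)" if "x \<in> U" "i < n" for x i
    using V[OF that(1)] is' that by (auto simp: smooth_on_def)
qed

lemma smooth_on_const:
  assumes "openin (Euclidean_space n) U"
  shows "smooth_on n U (\<lambda>_. c)"
  by (rule smooth_on_coinduct[OF assms, where \<F> = "range (\<lambda>c _. c)"])
     (auto intro!: exI[of _ 0])

lemma smooth_on_scaled_coordinate:
  fixes a :: "'b::real_normed_vector"
  assumes U: "openin (Euclidean_space n) U"
  shows "smooth_on n U (\<lambda>x. x j *\<^sub>R a)"
proof (rule smooth_on_coinduct[OF U, where \<F> = "insert (\<lambda>x. x j *\<^sub>R a) (range (\<lambda>c _. c))"])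
  fix g assume g: "g \<in> insert (\<lambda>x. x j *\<^sub>R a) (range (\<lambda>c _. c))"
  have "continuous_map (Euclidean_space n) euclideanreal (\<lambda>x. x j)"
    unfolding Euclidean_space_def
    by (intro continuous_map_from_subtopology continuous_map_product_projection) simp
  then have "continuous_map (subtopology (Euclidean_space n) U) euclideanreal (\<lambda>x. x j)"
    by (rule continuous_map_from_subtopology)
  then have "continuous_map (subtopology (Euclidean_space n) U) euclidean ((\<lambda>t. t *\<^sub>R a) \<circ> (\<lambda>x. x j))"
    by (rule continuous_map_compose) (auto intro!: continuous_intros)
  then show "continuous_map (subtopology (Euclidean_space n) U) euclidean g"
    using g by (auto simp: o_def)
  fix i
  show "\<exists>g'\<in>insert (\<lambda>x. x j *\<^sub>R a) (range (\<lambda>c _. c)).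
      \<forall>x\<in>U. ((\<lambda>t. g (x(i := t))) has_vector_derivative g' x) (at (x i))"
  proof (cases "g = (\<lambda>x. x j *\<^sub>R a)")
    case True
    then show ?thesis
      by (intro bexI[of _ "\<lambda>_. if i = j then a else 0"])
         (auto intro!: derivative_eq_intros has_vector_derivative_scaleR)
  next
    case False
    then show ?thesis using g by (intro bexI[of _ "\<lambda>_. 0"]) auto
  qed
qed auto

lemma smooth_on_add:
  fixes f g :: "(nat \<Rightarrow> real) \<Rightarrow> 'b::real_normed_vector"
  assumes U: "openin (Euclidean_space n) U" and "smooth_on n U f" "smooth_on n U g"
  shows "smooth_on n U (\<lambda>x. f x + g x)"
proof (rule smooth_on_coinduct[OF U, where \<F> = "{\<lambda>x. f x + g x |f g. smooth_on n U f \<and> smooth_on n U g}"])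
  fix h :: "(nat \<Rightarrow> real) \<Rightarrow> 'b" assume "h \<in> {\<lambda>x. f x + g x |f g. smooth_on n U f \<and> smooth_on n U g}"
  then obtain f g where f: "smooth_on n U f" and g: "smooth_on n U g" and h: "h = (\<lambda>x. f x + g x)" by blast
  show "continuous_map (subtopology (Euclidean_space n) U) euclidean h"
    unfolding h by (intro continuous_map_add smooth_on_continuous_map f g)
  fix i assume i: "i < n"
  show "\<exists>h'\<in>{\<lambda>x. f x + g x |f g. smooth_on n U f \<and> smooth_on n U g}.
      \<forall>x\<in>U. ((\<lambda>t. h (x(i := t))) has_vector_derivative h' x) (at (x i))"
  proof (intro bexI[of _ "\<lambda>x. pderiv_at i f x + pderiv_at i g x"] ballI)
    show "((\<lambda>t. h (x(i := t))) has_vector_derivative pderiv_at i f x + pderiv_at i g x) (at (x i))"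
      if "x \<in> U" for x
      unfolding h
      by (intro has_vector_derivative_add smooth_on_has_vector_derivative[OF f i that]
          smooth_on_has_vector_derivative[OF g i that])
  qed (use smooth_on_pderiv_at[OF f i] smooth_on_pderiv_at[OF g i] in blast)
qed (use assms in auto)

lemma smooth_on_bounded_linear:
  assumes U: "openin (Euclidean_space n) U" and f: "smooth_on n U f" and l: "bounded_linear l"
  shows "smooth_on n U (\<lambda>x. l (f x))"
proof (rule smooth_on_coinduct[OF U, where \<F> = "(\<lambda>f x. l (f x)) ` {f. smooth_on n U f}"])
  fix g assume "g \<in> (\<lambda>f x. l (f x)) ` {f. smooth_on n U f}"
  then obtain f where f: "smooth_on n U f" and g: "g = (\<lambda>x. l (f x))" by blast
  have "continuous_map (subtopology (Euclidean_space n) U) euclidean (l \<circ> f)"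
    using smooth_on_continuous_map[OF f]
    by (rule continuous_map_compose) (simp add: l linear_continuous_on)
  then show "continuous_map (subtopology (Euclidean_space n) U) euclidean g" by (simp add: g o_def)
  fix i assume i: "i < n"
  show "\<exists>g'\<in>(\<lambda>f x. l (f x)) ` {f. smooth_on n U f}.
      \<forall>x\<in>U. ((\<lambda>t. g (x(i := t))) has_vector_derivative g' x) (at (x i))"
    using smooth_on_pderiv_at[OF f i] smooth_on_has_vector_derivative[OF f i]
      bounded_linear.has_vector_derivative[OF l]
    by (intro bexI[of _ "\<lambda>x. l (pderiv_at i f x)"]) (auto simp: g)
qed (use f in auto)

text \<open>
  Smoothness of functions of one real variable, as the largest predicate compatible with taking a
  derivative: this spares the choice of a sequence of higher derivatives.
\<close>

coinductive smooth1 :: "real set \<Rightarrow> (real \<Rightarrow> real) \<Rightarrow> bool" for S where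
  "smooth1 S \<phi>' \<Longrightarrow> (\<And>x. x \<in> S \<Longrightarrow> (\<phi> has_real_derivative \<phi>' x) (at x)) \<Longrightarrow> smooth1 S \<phi>"

lemma smooth1_imp_continuous_on: "smooth1 S \<phi> \<Longrightarrow> continuous_on S \<phi>"
  by (erule smooth1.cases) (meson DERIV_isCont continuous_at_imp_continuous_on)

text \<open>
  The partial derivatives of sums, products and composites are again built from sums, products and
  composites, so the closure under these operations is closed under differentiation.
\<close>

inductive smooth_closure :: "nat \<Rightarrow> (nat \<Rightarrow> real) set \<Rightarrow> ((nat \<Rightarrow> real) \<Rightarrow> real) \<Rightarrow> bool" for n U where
  base: "smooth_on n U f \<Longrightarrow> smooth_closure n U f"
| add: "smooth_closure n U f \<Longrightarrow> smooth_closure n U g \<Longrightarrow> smooth_closure n U (\<lambda>x. f x + g x)"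
| mult: "smooth_closure n U f \<Longrightarrow> smooth_closure n U g \<Longrightarrow> smooth_closure n U (\<lambda>x. f x * g x)"
| comp: "smooth_closure n U f \<Longrightarrow> smooth1 S \<phi> \<Longrightarrow> (\<And>x. x \<in> U \<Longrightarrow> f x \<in> S) \<Longrightarrow>
    smooth_closure n U (\<lambda>x. \<phi> (f x))"

lemma smooth_closure_continuous_map:
  assumes U: "openin (Euclidean_space n) U" and "smooth_closure n U f"
  shows "continuous_map (subtopology (Euclidean_space n) U) euclideanreal f"
  using assms(2)
proof induction
  case (comp f S \<phi>)
  have \<phi>: "continuous_map (top_of_set S) euclideanreal \<phi>"
    using smooth1_imp_continuous_on[OF comp.hyps(2)] by simp
  have "continuous_map (subtopology (Euclidean_space n) U) (top_of_set S) f"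
    using comp by (auto simp: continuous_map_in_subtopology)
  from continuous_map_compose[OF this \<phi>] show ?case by (simp add: o_def)
qed (auto intro: smooth_on_continuous_map continuous_map_add continuous_map_real_mult)

lemma smooth_closure_pderiv:
  assumes U: "openin (Euclidean_space n) U" and i: "i < n" and "smooth_closure n U f"
  shows "\<exists>f'. smooth_closure n U f' \<and>
    (\<forall>x\<in>U. ((\<lambda>t. f (x(i := t))) has_real_derivative f' x) (at (x i)))"
  using assms(3)
proof induction
  case (base f)
  then show ?case
    using smooth_closure.base[OF smooth_on_pderiv_at[OF base i]] smooth_on_has_vector_derivative[OF base i]
    by (auto simp only: has_real_derivative_iff_has_vector_derivative)
next
  case (add f g)
  then obtain f' g' where 1: "smooth_closure n U f'" "smooth_closure n U g'"
    and 2: "\<And>x. x \<in> U \<Longrightarrow> ((\<lambda>t. f (x(i := t))) has_real_derivative f' x) (at (x i))"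
    and 3: "\<And>x. x \<in> U \<Longrightarrow> ((\<lambda>t. g (x(i := t))) has_real_derivative g' x) (at (x i))"
    by blast
  show ?case
  proof (intro exI[of _ "\<lambda>x. f' x + g' x"] conjI ballI)
    show "smooth_closure n U (\<lambda>x. f' x + g' x)" by (rule smooth_closure.add[OF 1])
    show "((\<lambda>t. f (x(i := t)) + g (x(i := t))) has_real_derivative f' x + g' x) (at (x i))"
      if "x \<in> U" for x
      by (rule DERIV_add[OF 2[OF that] 3[OF that]])
  qed
next
  case (mult f g)
  then obtain f' g' where 1: "smooth_closure n U f'" "smooth_closure n U g'"
    and 2: "\<And>x. x \<in> U \<Longrightarrow> ((\<lambda>t. f (x(i := t))) has_real_derivative f' x) (at (x i))"
    and 3: "\<And>x. x \<in> U \<Longrightarrow> ((\<lambda>t. g (x(i := t))) has_real_derivative g' x) (at (x i))"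
    by blast
  show ?case
  proof (intro exI[of _ "\<lambda>x. f' x * g x + g' x * f x"] conjI ballI)
    show "smooth_closure n U (\<lambda>x. f' x * g x + g' x * f x)"
      by (rule smooth_closure.add[OF smooth_closure.mult[OF 1(1) mult.hyps(2)]
            smooth_closure.mult[OF 1(2) mult.hyps(1)]])
    show "((\<lambda>t. f (x(i := t)) * g (x(i := t))) has_real_derivative f' x * g x + g' x * f x) (at (x i))"
      if "x \<in> U" for x
      using DERIV_mult[OF 2[OF that] 3[OF that]] by simp
  qed
next
  case (comp f S \<phi>)
  then obtain f' where 1: "smooth_closure n U f'"
    and 2: "\<And>x. x \<in> U \<Longrightarrow> ((\<lambda>t. f (x(i := t))) has_real_derivative f' x) (at (x i))"
    by blast
  from \<open>smooth1 S \<phi>\<close> obtain \<phi>' where 3: "smooth1 S \<phi>'"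
    and 4: "\<And>x. x \<in> S \<Longrightarrow> (\<phi> has_real_derivative \<phi>' x) (at x)" by cases blast
  show ?case
  proof (intro exI[of _ "\<lambda>x. \<phi>' (f x) * f' x"] conjI ballI)
    show "smooth_closure n U (\<lambda>x. \<phi>' (f x) * f' x)"
      by (rule smooth_closure.mult[OF smooth_closure.comp[OF comp.hyps(1) 3 comp.hyps(3)] 1])
    show "((\<lambda>t. \<phi> (f (x(i := t)))) has_real_derivative \<phi>' (f x) * f' x) (at (x i))"
      if "x \<in> U" for x
      using DERIV_chain2[of \<phi> "\<phi>' (f x)" "\<lambda>t. f (x(i := t))", OF _ 2[OF that]] 4 comp that by simp
  qed
qed

lemma smooth_closure_imp_smooth_on:
  assumes U: "openin (Euclidean_space n) U" and "smooth_closure n U f"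
  shows "smooth_on n U f"
proof (rule smooth_on_coinduct[OF U, where \<F> = "Collect (smooth_closure n U)"])
  fix g i assume "g \<in> Collect (smooth_closure n U)" "i < n"
  then obtain g' where "smooth_closure n U g'"
    "\<And>x. x \<in> U \<Longrightarrow> ((\<lambda>t. g (x(i := t))) has_real_derivative g' x) (at (x i))"
    using smooth_closure_pderiv[OF U] by blast
  then show "\<exists>g'\<in>Collect (smooth_closure n U).
      \<forall>x\<in>U. ((\<lambda>t. g (x(i := t))) has_vector_derivative g' x) (at (x i))"
    unfolding has_real_derivative_iff_has_vector_derivative by blast
qed (use assms smooth_closure_continuous_map[OF U] in auto)

context
  fixes n :: nat and U :: "(nat \<Rightarrow> real) set"
  assumes U: "openin (Euclidean_space n) U"
begin

lemma smooth_on_mult: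
  "smooth_on n U f \<Longrightarrow> smooth_on n U g \<Longrightarrow> smooth_on n U (\<lambda>x. f x * g x :: real)"
  by (rule smooth_closure_imp_smooth_on[OF U smooth_closure.mult[OF smooth_closure.base smooth_closure.base]])

lemma smooth_on_smooth1:
  "smooth_on n U f \<Longrightarrow> smooth1 S \<phi> \<Longrightarrow> (\<And>x. x \<in> U \<Longrightarrow> f x \<in> S) \<Longrightarrow> smooth_on n U (\<lambda>x. \<phi> (f x))"
  by (rule smooth_closure_imp_smooth_on[OF U smooth_closure.comp[OF smooth_closure.base]])

lemma smooth_on_sum:
  "finite I \<Longrightarrow> (\<And>i. i \<in> I \<Longrightarrow> smooth_on n U (f i)) \<Longrightarrow> smooth_on n U (\<lambda>x. \<Sum>i\<in>I. f i x :: real)"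
  by (induction I rule: finite_induct) (simp_all add: smooth_on_const[OF U] smooth_on_add[OF U])

lemma smooth_on_real_polynomial_function:
  fixes q :: "'a::real_normed_vector \<Rightarrow> real"
  assumes "real_polynomial_function q"
    and "\<And>l :: 'a \<Rightarrow> real. bounded_linear l \<Longrightarrow> smooth_on n U (\<lambda>x. l (w x))"
  shows "smooth_on n U (\<lambda>x. q (w x))"
  using assms by induction (auto intro: smooth_on_const[OF U] smooth_on_add[OF U] smooth_on_mult)

end

text \<open>
  The inclusion of the real line as the first coordinate axis identifies functions of one variable
  with functions on \<^term>\<open>Euclidean_space 1\<close>.
\<close>

definition axis_point :: "real \<Rightarrow> nat \<Rightarrow> real" where
  "axis_point t = (\<lambda>i. if i = 0 then t else 0)"

lemma axis_point_simps [simp]: "axis_point t 0 = t" "(axis_point s)(0 := t) = axis_point t"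
  by (auto simp: axis_point_def)

lemma continuous_map_axis_point: "continuous_map euclideanreal (Euclidean_space 1) axis_point"
proof -
  have "axis_point = (\<lambda>t i. if i < 1 then t else 0)" by (auto simp: axis_point_def)
  moreover have "continuous_map euclideanreal (Euclidean_space 1) (\<lambda>t i. if i < 1 then t else 0)"
    by (subst continuous_map_componentwise_Euclidean_space) auto
  ultimately show ?thesis by simp
qed

lemma smooth1_of_smooth_on:
  assumes "smooth_on 1 U g" and "\<And>t. t \<in> S \<Longrightarrow> axis_point t \<in> U"
  shows "smooth1 S (\<lambda>t. g (axis_point t))"
proof -
  have "smooth1 S \<phi>" if "\<exists>g. smooth_on 1 U g \<and> \<phi> = (\<lambda>t. g (axis_point t))" for \<phi>
    using that
  proof (coinduction arbitrary: \<phi>)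
    case smooth1
    then obtain g where g: "smooth_on 1 U g" "\<phi> = (\<lambda>t. g (axis_point t))" by blast
    have "(\<phi> has_real_derivative pderiv_at 0 g (axis_point t)) (at t)" if "t \<in> S" for t
      using smooth_on_has_vector_derivative[OF g(1) _ assms(2)[OF that], of 0]
      by (simp add: g(2) has_real_derivative_iff_has_vector_derivative)
    then show ?case
      using smooth_on_pderiv_at[OF g(1), of 0]
      by (intro exI[of _ "\<lambda>t. pderiv_at 0 g (axis_point t)"] exI[of _ \<phi>]) auto
  qed
  then show ?thesis using assms(1) by blast
qed

section \<open>A bump profile and its dilation series\<close>

lemma poly_times_exp_minus_tendsto_0:
  fixes q :: "real poly"
  shows "((\<lambda>y. poly q y * exp (- y)) \<longlongrightarrow> 0) at_top"
proof -
  have "((\<lambda>y. \<Sum>i\<le>degree q. coeff q i * (y ^ i / exp y)) \<longlongrightarrow> (\<Sum>i\<le>degree q. coeff q i * 0)) at_top"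
    by (intro tendsto_intros tendsto_power_div_exp_0)
  then show ?thesis
    by (simp add: poly_altdef sum_distrib_right sum_divide_distrib exp_minus field_simps)
qed

text \<open>
  The derivatives of \<open>exp (-1/x)\<close>, extended by 0, are again of this form with a polynomial factor
  in \<open>1/x\<close>; the exponential beats the polynomial at 0.
\<close>

definition flat :: "real poly \<Rightarrow> real \<Rightarrow> real" where
  "flat q x = (if 0 < x then poly q (1 / x) * exp (- (1 / x)) else 0)"

lemma flat_has_real_derivative:
  "(flat q has_real_derivative flat ((q - pderiv q) * [:0, 0, 1:]) x) (at x)"
proof -
  consider "x < 0" | "x = 0" | "x > 0" by linarith
  then show ?thesis
  proof cases
    case 1
    have "((\<lambda>_. 0) has_real_derivative 0) (at x)" by simp
    then have "(flat q has_real_derivative 0) (at x)"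
      by (rule has_field_derivative_transform_within_open[of _ _ _ "{..<0}"])
         (use 1 in \<open>auto simp: flat_def\<close>)
    then show ?thesis using 1 by (simp add: flat_def)
  next
    case 2
    have "((\<lambda>y. poly (q * [:0, 1:]) (inverse y) * exp (- inverse y)) \<longlongrightarrow> 0) (at_right 0)"
      by (rule filterlim_compose[OF poly_times_exp_minus_tendsto_0 filterlim_inverse_at_top_right])
    then have "((\<lambda>y. (flat q y - flat q 0) / (y - 0)) \<longlongrightarrow> 0) (at_right 0)"
      by (rule Lim_transform_eventually)
         (auto simp: eventually_at_right_less flat_def field_simps intro!: eventually_at_rightI[of 0 1])
    moreover have "((\<lambda>y. (flat q y - flat q 0) / (y - 0)) \<longlongrightarrow> 0) (at_left 0)"
      by (rule Lim_transform_eventually[OF tendsto_const])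
         (auto simp: flat_def intro!: eventually_at_leftI[of "-1"])
    ultimately have "((\<lambda>y. (flat q y - flat q 0) / (y - 0)) \<longlongrightarrow> 0) (at 0)"
      by (simp add: filterlim_at_split)
    then show ?thesis using 2 by (simp add: has_field_derivative_iff flat_def)
  next
    case 3
    have "((\<lambda>x. poly q (1 / x) * exp (- (1 / x))) has_real_derivative
      flat ((q - pderiv q) * [:0, 0, 1:]) x) (at x)"
      using 3 by (auto intro!: derivative_eq_intros simp: flat_def power2_eq_square field_simps)
    then show ?thesis
      by (rule has_field_derivative_transform_within_open[of _ _ _ "{0<..}"])
         (use 3 in \<open>auto simp: flat_def\<close>)
  qed
qed

lemma smooth1_flat: "smooth1 UNIV (flat q)"
proof -
  have "smooth1 UNIV \<phi>" if "\<exists>q. \<phi> = flat q" for \<phi>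
    using that
    by (coinduction arbitrary: \<phi>) (use flat_has_real_derivative in blast)
  then show ?thesis by blast
qed

lemma smooth1_powr: "smooth1 {0<..} (\<lambda>x. c * x powr a)"
proof -
  have "smooth1 {0<..} \<phi>" if "\<exists>c a. \<phi> = (\<lambda>x. c * x powr a)" for \<phi>
    using that
  proof (coinduction arbitrary: \<phi>)
    case smooth1
    then obtain c a where \<phi>: "\<phi> = (\<lambda>x. c * x powr a)" by blast
    have "(\<phi> has_real_derivative c * a * x powr (a - 1)) (at x)" if "x \<in> {0<..}" for x
      using that by (auto simp: \<phi> intro!: derivative_eq_intros)
    then show ?case by (intro exI[of _ "\<lambda>x. c * a * x powr (a - 1)"] exI[of _ \<phi>]) auto
  qed
  then show ?thesis by blast
qed

text \<open>
  A smooth odd function supported in [-1, 1].  The normalization makes its derivative at 0 equal to 1.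
  Oddness is what lets a term (odd function of the direction) times (profile of the norm) restrict to a
  line as one smooth function of the signed distance.
\<close>

definition bump :: "real \<Rightarrow> real" where
  "bump t = t * (exp 1 * flat 1 (1 - t * t))"

lemma bump_uminus: "bump (- t) = - bump t"
  by (simp add: bump_def)

lemma bump_eq_0: "1 \<le> \<bar>t\<bar> \<Longrightarrow> bump t = 0"
  using mult_mono[of 1 "\<bar>t\<bar>" 1 "\<bar>t\<bar>"] by (simp add: bump_def flat_def)

lemma bump_DERIV_0: "(bump has_real_derivative 1) (at 0)"
  unfolding bump_def
  by (rule derivative_eq_intros DERIV_chain2[OF flat_has_real_derivative] refl)+
     (simp add: flat_def exp_minus)

lemma smooth1_bump: "smooth1 UNIV bump"
proof -
  define U where "U = topspace (Euclidean_space 1)"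
  have U: "openin (Euclidean_space 1) U" by (simp add: U_def)
  have x: "smooth_on 1 U (\<lambda>x. x 0)" using smooth_on_scaled_coordinate[OF U, of 0 "1::real"] by simp
  have "smooth_on 1 U (\<lambda>x. x 0 * (exp 1 * flat 1 (1 + (- 1) * (x 0 * x 0))))"
    by (intro smooth_on_mult[OF U] smooth_on_smooth1[OF U _ smooth1_flat] smooth_on_add[OF U]
        smooth_on_const[OF U] x) auto
  then have "smooth1 UNIV (\<lambda>t. axis_point t 0 * (exp 1 * flat 1 (1 + (- 1) * (axis_point t 0 * axis_point t 0))))"
    by (rule smooth1_of_smooth_on) (auto simp: U_def axis_point_def topspace_Euclidean_space)
  then show ?thesis by (simp add: bump_def[abs_def])
qed

lemma bounded_of_support:
  fixes \<psi> :: "real \<Rightarrow> real"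
  assumes "continuous_on UNIV \<psi>" and "\<And>t. 1 < \<bar>t\<bar> \<Longrightarrow> \<psi> t = 0"
  obtains M where "\<And>t. \<bar>\<psi> t\<bar> \<le> M"
proof -
  have "compact (\<psi> ` {- 1..1})"
    using assms(1) by (intro compact_continuous_image) (auto intro: continuous_on_subset)
  then have "\<exists>M. \<forall>t\<in>{- 1..1}. \<bar>\<psi> t\<bar> \<le> M"
    by (auto dest!: compact_imp_bounded simp: bounded_iff)
  then obtain M where M: "\<And>t. t \<in> {- 1..1} \<Longrightarrow> \<bar>\<psi> t\<bar> \<le> M" by blast
  have "\<bar>\<psi> t\<bar> \<le> M" for t
  proof (cases "\<bar>t\<bar> \<le> 1")
    case True
    then show ?thesis by (intro M) auto
  next
    case False
    then show ?thesis using assms(2)[of t] M[of 0] by auto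
  qed
  then show ?thesis using that by blast
qed

lemma derivative_eq_0_outside:
  fixes \<psi> \<psi>' :: "real \<Rightarrow> real"
  assumes der: "\<And>t. (\<psi> has_real_derivative \<psi>' t) (at t)"
    and supp: "\<And>t. 1 < \<bar>t\<bar> \<Longrightarrow> \<psi> t = 0" and t: "1 < \<bar>t\<bar>"
  shows "\<psi>' t = 0"
proof -
  have "((\<lambda>_. 0) has_real_derivative 0) (at t)" by simp
  then have "(\<psi> has_real_derivative 0) (at t)"
    by (rule has_field_derivative_transform_within_open[of _ _ _ "- cball 0 1"])
       (use t supp in auto)
  then show ?thesis using der DERIV_unique by blast
qed

text \<open>
  Termwise differentiation multiplies the n-th weight by \<open>2 ^ n\<close>; the Weierstrass test applies as soon
  as the new weights are summable.
\<close>

lemma dilation_series_DERIV: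
  fixes \<psi> \<psi>' :: "real \<Rightarrow> real"
  assumes "\<And>t. (\<psi> has_real_derivative \<psi>' t) (at t)" and "\<And>t. \<bar>\<psi>' t\<bar> \<le> M"
    and c: "summable (\<lambda>n. \<bar>c n\<bar>)" and c2: "summable (\<lambda>n. \<bar>c n\<bar> * 2 ^ n)"
  shows "((\<lambda>t. \<Sum>n. c n * \<psi> (2 ^ n * t)) has_real_derivative (\<Sum>n. c n * 2 ^ n * \<psi>' (2 ^ n * t))) (at t)"
proof (rule has_field_derivative_series'(2)[where S = UNIV and ?x0.0 = 0
    and f = "\<lambda>n t. c n * \<psi> (2 ^ n * t)" and f' = "\<lambda>n t. c n * 2 ^ n * \<psi>' (2 ^ n * t)"])
  show "((\<lambda>t. c n * \<psi> (2 ^ n * t)) has_real_derivative c n * 2 ^ n * \<psi>' (2 ^ n * x)) (at x within UNIV)" for n x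
    by (rule derivative_eq_intros DERIV_chain2[OF assms(1)] refl)+ simp
  show "uniformly_convergent_on UNIV (\<lambda>n x. \<Sum>i<n. c i * 2 ^ i * \<psi>' (2 ^ i * x))"
    by (rule Weierstrass_m_test'[where M = "\<lambda>n. \<bar>c n\<bar> * 2 ^ n * M"])
       (auto simp: abs_mult intro!: mult_left_mono assms(2) summable_mult2 c2)
  show "summable (\<lambda>n. c n * \<psi> (2 ^ n * 0))"
    using summable_rabs_cancel[OF c] by (simp add: summable_mult2)
qed auto

text \<open>
  The derivative is a series of the same kind, with profile \<open>\<psi>'\<close> and weights \<open>c n * 2 ^ n\<close>; weights
  summable against every \<open>(2 ^ k) ^ n\<close> are stable under this step, so coinduction applies.
\<close>

lemma smooth1_dilation_series:
  assumes "smooth1 UNIV \<psi>" and "\<And>t. 1 < \<bar>t\<bar> \<Longrightarrow> \<psi> t = 0"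
    and "\<And>k. summable (\<lambda>n. \<bar>c n\<bar> * (2 ^ k) ^ n)"
  shows "smooth1 UNIV (\<lambda>t. \<Sum>n. c n * \<psi> (2 ^ n * t))"
proof -
  have "smooth1 UNIV \<phi>"
    if "\<exists>\<psi> c. \<phi> = (\<lambda>t. \<Sum>n. c n * \<psi> (2 ^ n * t)) \<and> smooth1 UNIV \<psi> \<and> (\<forall>t. 1 < \<bar>t\<bar> \<longrightarrow> \<psi> t = 0) \<and>
      (\<forall>k. summable (\<lambda>n. \<bar>c n\<bar> * (2 ^ k) ^ n))" for \<phi>
    using that
  proof (coinduction arbitrary: \<phi>)
    case smooth1
    then obtain \<psi> c where \<phi>: "\<phi> = (\<lambda>t. \<Sum>n. c n * \<psi> (2 ^ n * t))" and "smooth1 UNIV \<psi>"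
      and supp: "\<And>t. 1 < \<bar>t\<bar> \<Longrightarrow> \<psi> t = 0"
      and c: "\<And>k. summable (\<lambda>n. \<bar>c n\<bar> * (2 ^ k) ^ n)" by blast
    from \<open>smooth1 UNIV \<psi>\<close> obtain \<psi>' where \<psi>': "smooth1 UNIV \<psi>'"
      and der: "\<And>t. (\<psi> has_real_derivative \<psi>' t) (at t)" by cases blast
    note supp' = derivative_eq_0_outside[OF der supp]
    obtain M where M: "\<And>t. \<bar>\<psi>' t\<bar> \<le> M"
      using bounded_of_support[OF smooth1_imp_continuous_on[OF \<psi>'] supp'] by blast
    have der\<phi>: "(\<phi> has_real_derivative (\<Sum>n. c n * 2 ^ n * \<psi>' (2 ^ n * t))) (at t)" for t
      unfolding \<phi> using c[of 0] c[of 1] by (intro dilation_series_DERIV[OF der M]) auto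
    have "summable (\<lambda>n. \<bar>c n * 2 ^ n\<bar> * (2 ^ k) ^ n)" for k
      using c[of "Suc k"] by (simp add: abs_mult power_mult_distrib mult.assoc)
    then have "\<exists>\<psi> d. (\<lambda>t. \<Sum>n. c n * 2 ^ n * \<psi>' (2 ^ n * t)) = (\<lambda>t. \<Sum>n. d n * \<psi> (2 ^ n * t)) \<and>
      smooth1 UNIV \<psi> \<and> (\<forall>t. 1 < \<bar>t\<bar> \<longrightarrow> \<psi> t = 0) \<and> (\<forall>k. summable (\<lambda>n. \<bar>d n\<bar> * (2 ^ k) ^ n))"
      using \<psi>' supp' by (intro exI[of _ \<psi>'] exI[of _ "\<lambda>n. c n * 2 ^ n"]) auto
    then show ?case using der\<phi>
      by (intro exI[of _ "\<lambda>t. \<Sum>n. c n * 2 ^ n * \<psi>' (2 ^ n * t)"] exI[of _ \<phi>]) auto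
  qed
  then show ?thesis using assms by blast
qed

section \<open>Smooth functions on the pencil plane\<close>

lemma pencil_open: "pencil n U p \<Longrightarrow> openin (Euclidean_space n) U"
  by (simp add: pencil_def)

text \<open>
  The two families of plots below suffice to test D-open sets and smooth functions: the parametrized
  lines through the origin see the behaviour at 0, and the plane chart sees that away from 0 the pencil
  plane is the ordinary plane.
\<close>

lemma pencil_through_line:
  assumes "openin (Euclidean_space 1) U" "v \<noteq> 0"
  shows "pencil 1 U (\<lambda>x. x 0 *\<^sub>R v)"
proof -
  have "(\<lambda>x. x 0 *\<^sub>R v) ` U \<subseteq> span {v}" by (auto simp: span_base span_scale)
  then show ?thesis
    using assms smooth_on_scaled_coordinate[OF assms(1), of 0 v] span_in_lines[OF assms(2)]
    unfolding pencil_def by blast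
qed

definition plane_chart :: "(nat \<Rightarrow> real) \<Rightarrow> real^2" where
  "plane_chart x = x 0 *\<^sub>R axis 1 1 + x 1 *\<^sub>R axis 2 1"

definition plane_coords :: "real^2 \<Rightarrow> nat \<Rightarrow> real" where
  "plane_coords v = (\<lambda>i. if i < 2 then (if i = 0 then v $ 1 else v $ 2) else 0)"

lemma plane_chart_coords [simp]: "plane_chart (plane_coords v) = v"
  by (simp add: plane_chart_def plane_coords_def vec_eq_iff forall_2 axis_def)

lemma continuous_map_plane_coords: "continuous_map euclidean (Euclidean_space 2) plane_coords"
  unfolding plane_coords_def
  by (subst continuous_map_componentwise_Euclidean_space) (auto intro!: continuous_intros)

lemma pencil_plane_chart:
  assumes "openin (Euclidean_space 2) U" "\<And>x. x \<in> U \<Longrightarrow> plane_chart x \<noteq> 0"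
  shows "pencil 2 U plane_chart"
proof -
  have "smooth_on 2 U plane_chart"
    unfolding plane_chart_def[abs_def]
    by (intro smooth_on_add smooth_on_scaled_coordinate assms(1))
  then show ?thesis using assms unfolding pencil_def by blast
qed

lemma openin_pencil_preimage:
  assumes "openin (D_topology UNIV pencil) B" "pencil n U p"
  shows "openin (Euclidean_space n) {u \<in> U. p u \<in> B}"
proof -
  have "openin (subtopology (Euclidean_space n) U) {u \<in> U. p u \<in> B}"
    using assms openin_D_topology[of pencil UNIV B] pencil_open by blast
  then show ?thesis using pencil_open[OF assms(2)] openin_trans_full by blast
qed

lemma open_pencil_line:
  assumes B: "openin (D_topology UNIV pencil) B" and v: "v \<noteq> 0"
  shows "open {t. t *\<^sub>R v \<in> B}"
proof -
  let ?E = "topspace (Euclidean_space 1)"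
  have "openin (Euclidean_space 1) {u \<in> ?E. u 0 *\<^sub>R v \<in> B}"
    by (rule openin_pencil_preimage[OF B pencil_through_line[OF _ v]]) simp
  from openin_continuous_map_preimage[OF continuous_map_axis_point this]
  show ?thesis by (simp add: axis_point_def topspace_Euclidean_space)
qed

lemma openin_plane_chart_preimage:
  assumes B: "openin (D_topology UNIV pencil) B"
  shows "openin (Euclidean_space 2) {u \<in> topspace (Euclidean_space 2). plane_chart u \<in> B - {0}}"
proof -
  let ?E = "topspace (Euclidean_space 2)"
  have "continuous_map (Euclidean_space 2) euclidean plane_chart"
    unfolding plane_chart_def[abs_def]
    using smooth_on_continuous_map[OF smooth_on_add[OF _ smooth_on_scaled_coordinate smooth_on_scaled_coordinate],
        of 2 ?E] by simp
  then have U: "openin (Euclidean_space 2) {u \<in> ?E. plane_chart u \<in> - {0}}"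
    by (rule openin_continuous_map_preimage) (simp add: open_Compl)
  have "{u \<in> {u \<in> ?E. plane_chart u \<in> - {0}}. plane_chart u \<in> B} = {u \<in> ?E. plane_chart u \<in> B - {0}}" by auto
  with openin_pencil_preimage[OF B pencil_plane_chart[OF U]] show ?thesis by auto
qed

lemma open_pencil_punctured:
  assumes B: "openin (D_topology UNIV pencil) B"
  shows "open (B - {0})"
proof -
  have "plane_coords v \<in> topspace (Euclidean_space 2)" for v
    by (simp add: plane_coords_def topspace_Euclidean_space)
  then show ?thesis
    using openin_continuous_map_preimage[OF continuous_map_plane_coords openin_plane_chart_preimage[OF B]]
    by (simp add: set_diff_eq)
qed

lemma smooth_functionsD:
  assumes "F \<in> smooth_functions D B" "D n U p" "p ` U \<subseteq> B"
  shows "smooth_on n U (\<lambda>u. F (p u))"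
  using assms
  by (auto simp: smooth_functions_def diff_smooth_def subset_diffeology_def standard_diffeology_def o_def)

lemma smooth_functionsI:
  assumes "F \<in> extensional B" "\<And>n U p. D n U p \<Longrightarrow> p ` U \<subseteq> B \<Longrightarrow> smooth_on n U (\<lambda>u. F (p u))"
    "\<And>n U p. D n U p \<Longrightarrow> openin (Euclidean_space n) U"
  shows "F \<in> smooth_functions D B"
  using assms
  by (auto simp: smooth_functions_def diff_smooth_def subset_diffeology_def standard_diffeology_def o_def)

lemma pencil_smooth_line:
  assumes B: "openin (D_topology UNIV pencil) B" and F: "F \<in> smooth_functions pencil B" and v: "v \<noteq> 0"
  shows "smooth1 {t. t *\<^sub>R v \<in> B} (\<lambda>t. F (t *\<^sub>R v))"
proof -
  define U where "U = {u \<in> topspace (Euclidean_space 1). u 0 *\<^sub>R v \<in> B}"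
  have U: "openin (Euclidean_space 1) U"
    unfolding U_def by (rule openin_pencil_preimage[OF B pencil_through_line[OF _ v]]) simp
  have "(\<lambda>x. x 0 *\<^sub>R v) ` U \<subseteq> B" by (auto simp: U_def)
  from smooth_functionsD[OF F pencil_through_line[OF U v] this]
  have "smooth_on 1 U (\<lambda>x. F (x 0 *\<^sub>R v))" .
  then have "smooth1 {t. t *\<^sub>R v \<in> B} (\<lambda>t. F (axis_point t 0 *\<^sub>R v))"
    by (rule smooth1_of_smooth_on) (auto simp: U_def axis_point_def topspace_Euclidean_space)
  then show ?thesis by simp
qed

lemma pencil_smooth_continuous_on:
  assumes B: "openin (D_topology UNIV pencil) B" and F: "F \<in> smooth_functions pencil B"
  shows "continuous_on (B - {0}) F"
proof -
  define U where "U = {u \<in> topspace (Euclidean_space 2). plane_chart u \<in> B - {0}}"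
  have "smooth_on 2 U (\<lambda>x. F (plane_chart x))"
    using openin_plane_chart_preimage[OF B]
    by (intro smooth_functionsD[OF F pencil_plane_chart]) (auto simp: U_def)
  then have "continuous_map (subtopology (Euclidean_space 2) U) euclideanreal (\<lambda>x. F (plane_chart x))"
    by (rule smooth_on_continuous_map)
  moreover have "continuous_map (top_of_set (B - {0})) (subtopology (Euclidean_space 2) U) plane_coords"
    unfolding continuous_map_in_subtopology
    by (auto simp: U_def continuous_map_from_subtopology continuous_map_plane_coords)
      (simp add: plane_coords_def topspace_Euclidean_space)
  ultimately have "continuous_map (top_of_set (B - {0})) euclideanreal ((\<lambda>x. F (plane_chart x)) \<circ> plane_coords)"
    by (rule continuous_map_compose[rotated])
  then show ?thesis by (simp add: o_def)
qed

section \<open>Directional derivatives are sigma-continuous\<close>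

text \<open>
  By the mean value theorem the difference quotient \<open>g t / t\<close> is a value of the derivative at an
  intermediate point, and the derivative is itself differentiable at 0.  It is this rate that a function
  merely differentiable at 0 would not provide.
\<close>

lemma smooth1_quotient_bound:
  assumes S: "open S" "0 \<in> S" and g: "smooth1 S g" and "g 0 = 0"
    and d: "(g has_real_derivative d) (at 0)"
  shows "\<exists>\<delta>>0. \<exists>M. \<forall>t. 0 < t \<and> t < \<delta> \<longrightarrow> \<bar>g t / t - d\<bar> \<le> M * t"
proof -
  from g obtain g' where g': "smooth1 S g'" "\<And>t. t \<in> S \<Longrightarrow> (g has_real_derivative g' t) (at t)"
    by cases blast
  from g'(1) obtain e where "(g' has_real_derivative e) (at 0)" using S by cases blast
  then have "((\<lambda>t. (g' t - g' 0) / t) \<longlongrightarrow> e) (at 0)"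
    by (simp add: has_field_derivative_iff)
  then have "eventually (\<lambda>t. dist ((g' t - g' 0) / t) e < 1) (at 0)"
    by (rule tendstoD) simp
  then obtain \<delta>1 where \<delta>1: "\<delta>1 > 0" "\<And>t. t \<noteq> 0 \<Longrightarrow> \<bar>t\<bar> < \<delta>1 \<Longrightarrow> dist ((g' t - g' 0) / t) e < 1"
    unfolding eventually_at by auto
  obtain \<delta>2 where \<delta>2: "\<delta>2 > 0" "ball 0 \<delta>2 \<subseteq> S" using S openE by blast
  have d': "d = g' 0" using g'(2)[OF S(2)] d DERIV_unique by blast
  have "\<bar>g t / t - d\<bar> \<le> (\<bar>e\<bar> + 1) * t" if t: "0 < t" "t < min \<delta>1 \<delta>2" for t
  proof -
    have "\<exists>z. 0 < z \<and> z < t \<and> g t - g 0 = (t - 0) * g' z"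
      using t \<delta>2 by (intro MVT2 g'(2)) auto
    then obtain z where z: "0 < z" "z < t" "g t = t * g' z" using \<open>g 0 = 0\<close> by auto
    have "\<bar>(g' z - g' 0) / z - e\<bar> < 1" using \<delta>1(2)[of z] z t by (simp add: dist_real_def)
    then have "\<bar>(g' z - g' 0) / z\<bar> \<le> \<bar>e\<bar> + 1" by linarith
    then have "\<bar>g' z - g' 0\<bar> \<le> (\<bar>e\<bar> + 1) * z" using z by (simp add: field_simps)
    also have "\<dots> \<le> (\<bar>e\<bar> + 1) * t" using z by (intro mult_left_mono) auto
    finally show ?thesis using z t by (simp add: d')
  qed
  then show ?thesis using \<delta>1(1) \<delta>2(1) by (intro exI[of _ "min \<delta>1 \<delta>2"]) auto
qed

text \<open>
  The k-th piece collects the directions along which the difference quotients converge with rate k on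
  the window (0, 1/(k+1)].  The condition is imposed only at those times at which the ray meets B: a
  neighbourhood B contains an initial segment of every ray, but the directions whose initial segment of
  a given length lies in B need not form a closed set.  As stated, the condition passes to limits of
  directions, because B is open away from 0 and F is continuous there.
\<close>

lemma sigma_continuous_directional_derivative:
  assumes B: "openin (D_topology UNIV pencil) B" "0 \<in> B" and F: "F \<in> smooth_functions pencil B" "F 0 = 0"
    and h: "\<And>v. v \<in> circle \<Longrightarrow> ((\<lambda>t. F (t *\<^sub>R v)) has_real_derivative h v) (at 0)"
  shows "sigma_continuous h"
proof -
  define C where "C k = {v \<in> circle. \<forall>s t. 0 < s \<and> s \<le> 1 / real (Suc k) \<and> 0 < t \<and> t \<le> 1 / real (Suc k) \<and>
    s *\<^sub>R v \<in> B \<and> t *\<^sub>R v \<in> B \<longrightarrow> \<bar>F (s *\<^sub>R v) / s - F (t *\<^sub>R v) / t\<bar> \<le> real (Suc k) * (s + t)}" for k :: nat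
  have nz: "v \<noteq> 0" if "v \<in> circle" for v using that by auto
  have ev_B: "\<forall>\<^sub>F i in sequentially. s *\<^sub>R v i \<in> B" and lim_F: "(\<lambda>i. F (s *\<^sub>R v i) / s) \<longlonglongrightarrow> F (s *\<^sub>R w) / s"
    if "v \<longlonglongrightarrow> w" "w \<in> circle" "s > 0" "s *\<^sub>R w \<in> B" for v :: "nat \<Rightarrow> real^2" and w s
  proof -
    have lim: "(\<lambda>i. s *\<^sub>R v i) \<longlonglongrightarrow> s *\<^sub>R w" by (intro tendsto_intros that)
    have w: "s *\<^sub>R w \<in> B - {0}" using that nz by auto
    from topological_tendstoD[OF lim open_pencil_punctured[OF B(1)] w]
    show "\<forall>\<^sub>F i in sequentially. s *\<^sub>R v i \<in> B" by eventually_elim simp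
    have "isCont F (s *\<^sub>R w)"
      using pencil_smooth_continuous_on[OF B(1) F(1)] open_pencil_punctured[OF B(1)] w
      by (simp add: continuous_on_eq_continuous_at)
    then show "(\<lambda>i. F (s *\<^sub>R v i) / s) \<longlonglongrightarrow> F (s *\<^sub>R w) / s"
      using that by (intro tendsto_intros isCont_tendsto_compose[OF _ lim]) auto
  qed
  have ev_line: "\<forall>\<^sub>F t in at_right 0. t *\<^sub>R w \<in> B \<and> 0 < t \<and> t < e" if "w \<in> circle" "e > 0" for w and e :: real
  proof -
    have "\<forall>\<^sub>F t in nhds 0. t *\<^sub>R w \<in> B"
      using open_pencil_line[OF B(1) nz[OF that(1)]] B(2) by (auto simp: eventually_nhds)
    then have "\<forall>\<^sub>F t in at_right 0. t *\<^sub>R w \<in> B" by (simp add: eventually_nhds_conv_at eventually_at_split)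
    moreover have "\<forall>\<^sub>F t in at_right 0. 0 < t \<and> t < e"
      using that by (auto intro: eventually_at_rightI[of 0 e])
    ultimately show ?thesis by eventually_elim simp
  qed
  \<comment> \<open>Letting the second parameter tend to 0 turns the defining inequality into a rate of
      convergence that is uniform on the set.\<close>
  have rate: "\<bar>F (s *\<^sub>R w) / s - h w\<bar> \<le> real (Suc k) * s"
    if w: "w \<in> C k" and s: "0 < s" "s \<le> 1 / real (Suc k)" "s *\<^sub>R w \<in> B" for w s k
  proof -
    have wc: "w \<in> circle" using w by (simp add: C_def)
    have "((\<lambda>t. F (t *\<^sub>R w) / t) \<longlongrightarrow> h w) (at 0)"
      using h[OF wc] F(2) by (simp add: has_field_derivative_iff)
    then have "((\<lambda>t. F (t *\<^sub>R w) / t) \<longlongrightarrow> h w) (at_right 0)" by (simp add: filterlim_at_split)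
    then have "((\<lambda>t. \<bar>F (s *\<^sub>R w) / s - F (t *\<^sub>R w) / t\<bar>) \<longlongrightarrow> \<bar>F (s *\<^sub>R w) / s - h w\<bar>) (at_right 0)"
      by (intro tendsto_intros)
    moreover have "((\<lambda>t. real (Suc k) * (s + t)) \<longlongrightarrow> real (Suc k) * (s + 0)) (at_right 0)" by (intro tendsto_intros)
    moreover have "\<forall>\<^sub>F t in at_right 0. t *\<^sub>R w \<in> B \<and> 0 < t \<and> t < 1 / real (Suc k)"
      by (rule ev_line[OF wc]) simp
    then have "\<forall>\<^sub>F t in at_right 0. \<bar>F (s *\<^sub>R w) / s - F (t *\<^sub>R w) / t\<bar> \<le> real (Suc k) * (s + t)"
      by (rule eventually_mono) (use w s in \<open>auto simp: C_def\<close>)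
    ultimately have "\<bar>F (s *\<^sub>R w) / s - h w\<bar> \<le> real (Suc k) * (s + 0)"
      by (intro tendsto_le[of "at_right 0"]) auto
    then show ?thesis by simp
  qed
  have "closed (C k)" for k
    unfolding closed_sequential_limits
  proof (intro allI impI; elim conjE)
    fix v w assume v: "\<forall>i. v i \<in> C k" and lim: "v \<longlonglongrightarrow> w"
    have wc: "w \<in> circle"
      by (rule closed_sequentially[OF closed_sphere _ lim]) (use v in \<open>auto simp: C_def\<close>)
    have "\<bar>F (s *\<^sub>R w) / s - F (t *\<^sub>R w) / t\<bar> \<le> real (Suc k) * (s + t)"
      if st: "0 < s" "s \<le> 1 / real (Suc k)" "0 < t" "t \<le> 1 / real (Suc k)" "s *\<^sub>R w \<in> B" "t *\<^sub>R w \<in> B" for s t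
    proof (rule tendsto_upperbound)
      show "(\<lambda>i. \<bar>F (s *\<^sub>R v i) / s - F (t *\<^sub>R v i) / t\<bar>) \<longlonglongrightarrow> \<bar>F (s *\<^sub>R w) / s - F (t *\<^sub>R w) / t\<bar>"
        using st by (intro tendsto_intros lim_F lim wc)
      show "\<forall>\<^sub>F i in sequentially. \<bar>F (s *\<^sub>R v i) / s - F (t *\<^sub>R v i) / t\<bar> \<le> real (Suc k) * (s + t)"
        using ev_B[OF lim wc st(1,5)] ev_B[OF lim wc st(3,6)]
        by eventually_elim (use v st in \<open>auto simp: C_def\<close>)
    qed simp
    then show "w \<in> C k" using wc by (simp add: C_def)
  qed
  moreover have "C k \<subseteq> circle" for k by (auto simp: C_def)
  ultimately have closed: "closedin (top_of_set circle) (C k)" for k by (simp add: closed_subset)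
  have "continuous_on (C k) h" for k
  proof (rule continuous_on_sequentiallyI)
    fix v w assume v: "\<forall>i. v i \<in> C k" and w: "w \<in> C k" and lim: "v \<longlonglongrightarrow> w"
    have wc: "w \<in> circle" using w by (simp add: C_def)
    show "(\<lambda>i. h (v i)) \<longlonglongrightarrow> h w"
    proof (rule tendstoI)
      fix e :: real assume e: "e > 0"
      have "\<forall>\<^sub>F s in at_right 0. s *\<^sub>R w \<in> B \<and> 0 < s \<and> s < min (1 / real (Suc k)) (e / (3 * real (Suc k)))"
        using e by (intro ev_line[OF wc]) auto
      then obtain s where s: "s *\<^sub>R w \<in> B" "0 < s" "s < 1 / real (Suc k)" "s < e / (3 * real (Suc k))"
        by (auto dest!: eventually_happens)
      have small: "real (Suc k) * s < e / 3" using s(4) by (simp add: field_simps)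
      have "\<forall>\<^sub>F i in sequentially. dist (F (s *\<^sub>R v i) / s) (F (s *\<^sub>R w) / s) < e / 3"
        using e by (intro tendstoD lim_F[OF lim wc s(2,1)]) auto
      with ev_B[OF lim wc s(2,1)] show "\<forall>\<^sub>F i in sequentially. dist (h (v i)) (h w) < e"
      proof eventually_elim
        case (elim i)
        have "\<bar>F (s *\<^sub>R v i) / s - h (v i)\<bar> \<le> real (Suc k) * s" "\<bar>F (s *\<^sub>R w) / s - h w\<bar> \<le> real (Suc k) * s"
          using rate[of "v i" k s] rate[of w k s] v w s elim by auto
        then show ?case using elim small unfolding dist_real_def by linarith
      qed
    qed
  qed
  moreover have "circle = (\<Union>k. C k)"
  proof
    show "circle \<subseteq> (\<Union>k. C k)"
    proof
      fix v assume v: "v \<in> circle"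
      obtain \<delta> M where \<delta>: "\<delta> > 0" and M: "\<And>t. 0 < t \<Longrightarrow> t < \<delta> \<Longrightarrow> \<bar>F (t *\<^sub>R v) / t - h v\<bar> \<le> M * t"
        using smooth1_quotient_bound[OF open_pencil_line[OF B(1) nz[OF v]] _
            pencil_smooth_line[OF B(1) F(1) nz[OF v]] _ h[OF v]] B(2) F(2) by auto
      \<comment> \<open>One index serves both as the rate and as the inverse length of the window.\<close>
      obtain k :: nat where k: "k > max M (1 / \<delta>)" using reals_Archimedean2 by blast
      have "1 / real (Suc k) < \<delta>" using k \<delta> by (simp add: field_simps)
      have "v \<in> C k"
        unfolding C_def
      proof (intro CollectI conjI allI impI v)
        fix s t assume st: "0 < s \<and> s \<le> 1 / real (Suc k) \<and> 0 < t \<and> t \<le> 1 / real (Suc k) \<and> s *\<^sub>R v \<in> B \<and> t *\<^sub>R v \<in> B"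
        have "\<bar>F (s *\<^sub>R v) / s - h v\<bar> \<le> M * s" "\<bar>F (t *\<^sub>R v) / t - h v\<bar> \<le> M * t"
          using M st \<open>1 / real (Suc k) < \<delta>\<close> by auto
        then have "\<bar>F (s *\<^sub>R v) / s - F (t *\<^sub>R v) / t\<bar> \<le> M * (s + t)" by (simp add: distrib_left)
        also have "\<dots> \<le> real (Suc k) * (s + t)" using k st by (intro mult_right_mono) auto
        finally show "\<bar>F (s *\<^sub>R v) / s - F (t *\<^sub>R v) / t\<bar> \<le> real (Suc k) * (s + t)" .
      qed
      then show "v \<in> (\<Union>k. C k)" by blast
    qed
  qed (auto simp: C_def)
  ultimately show ?thesis using closed unfolding sigma_continuous_def by blast
qed

section \<open>Realizing odd sigma-continuous functions\<close>

text \<open>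
  The Weierstrass theorem need not give an odd polynomial, but passing to the odd part averages the
  errors at \<open>v\<close> and \<open>-v\<close>, both of which lie in the symmetric set.
\<close>

lemma odd_polynomial_approximation:
  assumes K: "compact K" "\<And>v. v \<in> K \<Longrightarrow> - v \<in> K" and h: "continuous_on K h"
    and odd: "\<And>v. v \<in> K \<Longrightarrow> h (- v) = - h v" and e: "e > 0"
  obtains q :: "'a::euclidean_space \<Rightarrow> real"
  where "real_polynomial_function q" "\<And>v. q (- v) = - q v" "\<And>v. v \<in> K \<Longrightarrow> \<bar>h v - q v\<bar> < e"
proof -
  obtain g where g: "real_polynomial_function g" "\<And>x. x \<in> K \<Longrightarrow> \<bar>h x - g x\<bar> < e"
    using Stone_Weierstrass_real_polynomial_function[OF K(1) h e] by blast
  have "real_polynomial_function (g \<circ> uminus)"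
    by (rule real_polynomial_function_compose[OF _ g(1)])
       (intro polynomial_function_bounded_linear bounded_linear_minus bounded_linear_ident)
  then have "real_polynomial_function (\<lambda>v. 1 / 2 * g v + (- (1 / 2)) * g (- v))"
    unfolding o_def by (intro real_polynomial_function.intros(2-4) g(1))
  moreover have "\<bar>h v - (1 / 2 * g v + (- (1 / 2)) * g (- v))\<bar> < e" if "v \<in> K" for v
    using g(2)[OF that] g(2)[OF K(2)[OF that]] odd[OF that] by linarith
  ultimately show ?thesis by (intro that) auto
qed

text \<open>
  The continuity pieces may be added up: a finite union of closed pieces is again one, and so is the
  antipode of a piece because the function is odd.
\<close>

lemma Odd_sigma_exhaustion:
  assumes h: "h \<in> Odd" "sigma_continuous h"
  obtains K :: "nat \<Rightarrow> (real^2) set"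
  where "\<And>n. compact (K n)" "\<And>n v. v \<in> K n \<Longrightarrow> - v \<in> K n" "\<And>n. continuous_on (K n) h" "incseq K"
    "circle = (\<Union>n. K n)"
proof -
  from h(2)[unfolded sigma_continuous_def] obtain C :: "nat \<Rightarrow> (real^2) set"
    where C': "(\<forall>n. closedin (top_of_set circle) (C n)) \<and> circle = (\<Union>n. C n) \<and>
      (\<forall>n. continuous_on (C n) h)"
    by (rule exE)
  note C = C'[THEN conjunct1, rule_format] C'[THEN conjunct2, THEN conjunct1]
    C'[THEN conjunct2, THEN conjunct2, rule_format]
  define K where "K n = (\<Union>k\<le>n. C k \<union> uminus ` C k)" for n :: nat
  have clC: "closed (C n)" for n by (rule closedin_closed_trans[OF C(1) closed_sphere])
  have Csub: "C n \<subseteq> circle" for n using C(2) by auto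
  have cl: "closed (C n \<union> uminus ` C n)" for n using clC closed_negations by blast
  have cont: "continuous_on (C n \<union> uminus ` C n) h" for n
  proof (rule continuous_on_closed_Un)
    have "continuous_on (uminus ` C n) (\<lambda>v. - h (- v))"
      by (intro continuous_intros continuous_on_compose2[OF C(3)[of n]]) auto
    moreover have "- h (- v) = h v" if v: "v \<in> uminus ` C n" for v
    proof -
      obtain x where x: "x \<in> C n" "v = - x" using v by blast
      then have "x \<in> circle" using Csub by blast
      then show ?thesis using h(1) x(2) by (simp add: Odd_def)
    qed
    ultimately show "continuous_on (uminus ` C n) h" by (simp cong: continuous_on_cong)
  qed (use clC C(3) closed_negations in auto)
  have Ksub: "K n \<subseteq> circle" for n using Csub by (fastforce simp: K_def)
  show ?thesis
  proof
    show "compact (K n)" for n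
    proof -
      have "closed (K n)" unfolding K_def using cl by (intro closed_UN) auto
      moreover have "bounded (K n)" by (rule bounded_subset[OF bounded_sphere Ksub])
      ultimately show ?thesis by (simp add: compact_eq_bounded_closed)
    qed
    show "continuous_on (K n) h" for n
    proof (induction n)
      case 0
      then show ?case using cont[of 0] by (simp add: K_def)
    next
      case (Suc n)
      have "K (Suc n) = K n \<union> (C (Suc n) \<union> uminus ` C (Suc n))"
        unfolding K_def atMost_Suc UN_insert by (rule Un_commute)
      moreover have "closed (K n)" unfolding K_def using cl by (intro closed_UN) auto
      ultimately show ?case using continuous_on_closed_Un[OF _ cl Suc cont] by simp
    qed
    show "- v \<in> K n" if "v \<in> K n" for n v using that by (force simp: K_def)
    show "incseq K" by (force simp: K_def incseq_def)
    show "circle = (\<Union>n. K n)" using Ksub C(2) by (force simp: K_def)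
  qed
qed

text \<open>
  The terms are the differences of successive odd polynomial approximations on an exhaustion.  A point
  belongs to the exhausting sets only from some index on, so the bound on the terms starts at an index
  that depends on the point.  Factorial decay is chosen because it beats the factors
  \<open>2 ^ (k * n)\<close> that k derivatives of the n-th dilate produce.
\<close>

lemma Odd_sigma_polynomial_series:
  assumes h: "h \<in> Odd" "sigma_continuous h"
  obtains d :: "nat \<Rightarrow> real^2 \<Rightarrow> real"
  where "\<And>n. real_polynomial_function (d n)" "\<And>n v. d n (- v) = - d n v"
    "\<And>v. v \<in> circle \<Longrightarrow> (\<lambda>n. d n v) sums h v"
    "\<And>v. v \<in> circle \<Longrightarrow> \<exists>N. \<forall>n\<ge>N. \<bar>d n v\<bar> \<le> 2 / fact n"
proof -
  obtain K where K: "\<And>n. compact (K n)" "\<And>n v. v \<in> K n \<Longrightarrow> - v \<in> K n" "\<And>n. continuous_on (K n) h"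
    and "incseq K" and union: "circle = (\<Union>n. K n)"
    using Odd_sigma_exhaustion[OF h] by blast
  have "\<exists>q. real_polynomial_function q \<and> (\<forall>v. q (- v) = - q v) \<and> (\<forall>v\<in>K n. \<bar>h v - q v\<bar> < 1 / fact (Suc n))" for n
  proof -
    have "h (- v) = - h v" if "v \<in> K n" for v using that h(1) union by (auto simp: Odd_def)
    then show ?thesis
      using odd_polynomial_approximation[OF K(1) K(2) K(3), of n "1 / fact (Suc n)"]
      by (metis fact_gt_zero zero_less_divide_1_iff)
  qed
  then obtain q where q: "\<And>n. real_polynomial_function (q n)" "\<And>n v. q n (- v) = - q n v"
    and approx: "\<And>n v. v \<in> K n \<Longrightarrow> \<bar>h v - q n v\<bar> < 1 / fact (Suc n)" by metis
  define d where "d n v = (case n of 0 \<Rightarrow> q 0 v | Suc m \<Rightarrow> q (Suc m) v + (- 1) * q m v)" for n v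
  have partial_sum: "(\<Sum>i<Suc n. d i v) = q n v" for n v
    by (induction n) (simp_all add: d_def)
  have later: "\<bar>h v - q n v\<bar> < 1 / fact (Suc n)" if "v \<in> K N" "N \<le> n" for v n N
    using approx \<open>incseq K\<close> that unfolding incseq_def by blast
  show ?thesis
  proof
    show "real_polynomial_function (d n)" for n
      unfolding d_def[abs_def]
      by (cases n) (auto intro!: real_polynomial_function.intros(2-4) q(1))
    show "d n (- v) = - d n v" for n v
      by (cases n) (simp_all add: d_def q(2))
    fix v assume "v \<in> circle"
    then obtain N where N: "v \<in> K N" using union by blast
    have "(\<lambda>n. q n v) \<longlonglongrightarrow> h v"
    proof (rule LIM_zero_cancel, rule Lim_null_comparison)
      show "\<forall>\<^sub>F n in sequentially. norm (q n v - h v) \<le> inverse (real (Suc n))"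
      proof (rule eventually_sequentiallyI)
        fix n assume "N \<le> n"
        have "real (Suc n) \<le> fact (Suc n)"
          by (metis fact_ge_self of_nat_fact of_nat_le_iff)
        then have "1 / fact (Suc n) \<le> inverse (real (Suc n))"
          by (simp only: inverse_eq_divide) (intro divide_left_mono, auto)
        then show "norm (q n v - h v) \<le> inverse (real (Suc n))"
          using later[OF N \<open>N \<le> n\<close>] by simp
      qed
    qed (rule LIMSEQ_inverse_real_of_nat)
    then have "(\<lambda>n. \<Sum>i<Suc n. d i v) \<longlonglongrightarrow> h v" by (simp only: partial_sum)
    then show "(\<lambda>n. d n v) sums h v"
      unfolding sums_def by (rule LIMSEQ_imp_Suc)
    have "\<bar>d n v\<bar> \<le> 2 / fact n" if n: "n \<ge> Suc N" for n
    proof -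
      obtain m where m: "n = Suc m" "N \<le> m" using n by (cases n) auto
      have "\<bar>d n v\<bar> \<le> 1 / fact (Suc n) + 1 / fact n"
        using later[OF N, of n] later[OF N, of m] m by (simp add: d_def)
      also have "\<dots> \<le> 1 / fact n + 1 / fact n"
        by (intro add_mono divide_left_mono fact_mono) auto
      finally show ?thesis by simp
    qed
    then show "\<exists>N. \<forall>n\<ge>N. \<bar>d n v\<bar> \<le> 2 / fact n" by blast
  qed
qed

lemma summable_fact_bound:
  fixes a :: "nat \<Rightarrow> real"
  assumes "\<forall>n\<ge>N. \<bar>a n\<bar> \<le> c / fact n"
  shows "summable (\<lambda>n. \<bar>a n\<bar> * b ^ n)"
proof (rule summable_comparison_test)
  have "norm (\<bar>a n\<bar> * b ^ n) \<le> c * (inverse (fact n) * \<bar>b\<bar> ^ n)" if "n \<ge> N" for n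
  proof -
    have "\<bar>a n\<bar> * \<bar>b\<bar> ^ n \<le> c / fact n * \<bar>b\<bar> ^ n"
      using assms that by (intro mult_right_mono) auto
    then show ?thesis by (simp add: abs_mult power_abs divide_inverse mult.assoc)
  qed
  then show "\<exists>N. \<forall>n\<ge>N. norm (\<bar>a n\<bar> * b ^ n) \<le> c * (inverse (fact n) * \<bar>b\<bar> ^ n)" by blast
  show "summable (\<lambda>n. c * (inverse (fact n) * \<bar>b\<bar> ^ n))" by (intro summable_mult summable_exp)
qed

text \<open>
  At distance r from 0 only the terms with \<open>2 ^ n * r < 1\<close> contribute, so away from 0 the sum is
  locally finite; as r tends to 0 along a ray every term enters, and the slopes add up.
\<close>

definition bump_series :: "(nat \<Rightarrow> real^2 \<Rightarrow> real) \<Rightarrow> real^2 \<Rightarrow> real" where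
  "bump_series d x = (\<Sum>n. d n (x /\<^sub>R norm x) / 2 ^ n * bump (2 ^ n * norm x))"

text \<open>
  For negative t the direction and the norm of \<open>t *\<^sub>R v\<close> are \<open>-v\<close> and \<open>-t\<close>; the two signs cancel.
\<close>

lemma bump_series_on_line:
  assumes "\<And>n v. d n (- v) = - d n v" and "v \<in> circle"
  shows "bump_series d (t *\<^sub>R v) = (\<Sum>n. d n v / 2 ^ n * bump (2 ^ n * t))"
proof -
  have v: "norm v = 1" using assms by simp
  consider "t > 0" | "t = 0" | "t < 0" by linarith
  then show ?thesis
  proof cases
    case 3
    then have "\<bar>t\<bar> = - t" by simp
    then show ?thesis using 3 v assms(1)[of _ v] by (simp add: bump_series_def bump_uminus)
  qed (use v in \<open>auto simp: bump_series_def bump_eq_0 bump_def\<close>)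
qed

text \<open>
  In a fixed direction the bump series is a dilation series with factorially small weights.  Every
  term has slope \<open>d n v\<close> at 0, as the bump has slope 1 and the dilation factor is divided out.
\<close>

lemma bump_series_smooth_on_lines:
  assumes odd: "\<And>n v. d n (- v) = - d n v" and "v \<in> circle"
    and bound: "\<forall>n\<ge>N. \<bar>d n v\<bar> \<le> 2 / fact n"
  shows "smooth1 UNIV (\<lambda>t. bump_series d (t *\<^sub>R v))"
    and "((\<lambda>t. bump_series d (t *\<^sub>R v)) has_real_derivative (\<Sum>n. d n v)) (at 0)"
proof -
  have c: "summable (\<lambda>n. \<bar>d n v / 2 ^ n\<bar> * b ^ n)" for b
    using summable_fact_bound[OF bound, of "b / 2"] by (simp add: power_divide)
  have supp: "bump t = 0" if "1 < \<bar>t\<bar>" for t using that bump_eq_0 by simp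
  show "smooth1 UNIV (\<lambda>t. bump_series d (t *\<^sub>R v))"
    unfolding bump_series_on_line[of d v, OF odd assms(2)]
    by (rule smooth1_dilation_series[OF smooth1_bump supp c])
  from smooth1_bump obtain b' where b': "smooth1 UNIV b'" "\<And>t. (bump has_real_derivative b' t) (at t)"
    by cases blast
  obtain M where M: "\<And>t. \<bar>b' t\<bar> \<le> M"
    using bounded_of_support[OF smooth1_imp_continuous_on[OF b'(1)] derivative_eq_0_outside[OF b'(2) supp]] by blast
  have "b' 0 = 1" using b'(2) bump_DERIV_0 DERIV_unique by blast
  then show "((\<lambda>t. bump_series d (t *\<^sub>R v)) has_real_derivative (\<Sum>n. d n v)) (at 0)"
    using dilation_series_DERIV[OF b'(2) M, of "\<lambda>n. d n v / 2 ^ n" 0] c[of 1] c[of 2]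
    unfolding bump_series_on_line[of d v, OF odd assms(2)] by simp
qed

lemma bump_series_eventually_finite:
  assumes "2 ^ N * norm x \<ge> 1"
  shows "bump_series d x = (\<Sum>n<N. d n (x /\<^sub>R norm x) / 2 ^ n * bump (2 ^ n * norm x))"
  unfolding bump_series_def
proof (rule suminf_finite)
  fix n assume "n \<notin> {..<N}"
  then have "(2::real) ^ N \<le> 2 ^ n" by (intro power_increasing) auto
  then have "2 ^ N * norm x \<le> 2 ^ n * norm x" by (rule mult_right_mono) simp
  then show "d n (x /\<^sub>R norm x) / 2 ^ n * bump (2 ^ n * norm x) = 0"
    using assms by (simp add: bump_eq_0)
qed simp

text \<open>
  The norm is the composite of a sum of squares with a real power, which is smooth on the positive
  half-line; the exponents 1 and -1 give the norm and its inverse.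
\<close>

lemma smooth_on_norm_powr:
  fixes p :: "(nat \<Rightarrow> real) \<Rightarrow> real^2"
  assumes U: "openin (Euclidean_space n) U" and p: "smooth_on n U p" and nz: "\<And>u. u \<in> U \<Longrightarrow> p u \<noteq> 0"
  shows "smooth_on n U (\<lambda>u. norm (p u) powr a)"
proof -
  have comp: "smooth_on n U (\<lambda>u. p u $ i)" for i
    by (rule smooth_on_bounded_linear[OF U p bounded_linear_vec_nth])
  have sq: "p u $ 1 * p u $ 1 + p u $ 2 * p u $ 2 = norm (p u) ^ 2" for u
    by (simp add: power2_norm_eq_inner inner_vec_def sum_2)
  have "smooth_on n U (\<lambda>u. 1 * (p u $ 1 * p u $ 1 + p u $ 2 * p u $ 2) powr (a / 2))"
  proof (rule smooth_on_smooth1[OF U _ smooth1_powr])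
    show "smooth_on n U (\<lambda>u. p u $ 1 * p u $ 1 + p u $ 2 * p u $ 2)"
      by (intro smooth_on_add[OF U] smooth_on_mult[OF U] comp)
    show "p u $ 1 * p u $ 1 + p u $ 2 * p u $ 2 \<in> {0<..}" if "u \<in> U" for u
      using nz[OF that] by (simp add: sq)
  qed
  moreover have "(norm (p u) ^ 2) powr (a / 2) = norm (p u) powr a" for u
  proof (cases "p u = 0")
    case False
    then have "norm (p u) ^ 2 = norm (p u) powr 2" by simp
    then show ?thesis by (simp only: powr_powr) simp
  qed simp
  ultimately show ?thesis by (simp add: sq)
qed

lemma smooth_on_bump_series_nonzero:
  fixes p :: "(nat \<Rightarrow> real) \<Rightarrow> real^2"
  assumes U: "openin (Euclidean_space n) U" and p: "smooth_on n U p"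
    and far: "\<And>u. u \<in> U \<Longrightarrow> 2 ^ N * norm (p u) \<ge> 1"
    and d: "\<And>n. real_polynomial_function (d n)"
  shows "smooth_on n U (\<lambda>u. bump_series d (p u))"
proof -
  have nz: "p u \<noteq> 0" if "u \<in> U" for u using far[OF that] by auto
  have norm: "smooth_on n U (\<lambda>u. norm (p u))"
    by (rule smooth_on_cong[OF U smooth_on_norm_powr[OF U p nz, of 1]]) auto
  have inv: "smooth_on n U (\<lambda>u. inverse (norm (p u)))"
    by (rule smooth_on_cong[OF U smooth_on_norm_powr[OF U p nz, of "- 1"]]) (simp_all add: powr_minus)
  have dir: "smooth_on n U (\<lambda>u. d k (p u /\<^sub>R norm (p u)))" for k
  proof (rule smooth_on_real_polynomial_function[OF U d])
    fix l :: "real^2 \<Rightarrow> real" assume l: "bounded_linear l"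
    have "l (p u /\<^sub>R norm (p u)) = inverse (norm (p u)) * l (p u)" for u
      by (simp add: linear_simps l)
    then show "smooth_on n U (\<lambda>u. l (p u /\<^sub>R norm (p u)))"
      using smooth_on_mult[OF U inv smooth_on_bounded_linear[OF U p l]] by simp
  qed
  have "smooth_on n U (\<lambda>u. \<Sum>k<N. d k (p u /\<^sub>R norm (p u)) * (inverse (2 ^ k) * bump (2 ^ k * norm (p u))))"
    by (intro smooth_on_sum[OF U] smooth_on_mult[OF U] dir smooth_on_const[OF U] norm
        smooth_on_smooth1[OF U _ smooth1_bump]) auto
  then show ?thesis
    by (rule smooth_on_cong[OF U]) (simp add: bump_series_eventually_finite[OF far] divide_inverse mult.assoc)
qed

text \<open>
  The two kinds of germs of plots: where the plot is nonzero the series is locally a finite sum, and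
  where it stays on a line it is a smooth function of the coordinate on that line.
\<close>

lemma bump_series_smooth_functions:
  assumes poly: "\<And>n. real_polynomial_function (d n)" and odd: "\<And>n v. d n (- v) = - d n v"
    and bound: "\<And>v. v \<in> circle \<Longrightarrow> \<exists>N. \<forall>n\<ge>N. \<bar>d n v\<bar> \<le> 2 / fact n"
  shows "bump_series d \<in> smooth_functions pencil UNIV"
proof (rule smooth_functionsI)
  fix n U p assume p: "pencil n U p"
  show "smooth_on n U (\<lambda>u. bump_series d (p u))"
  proof (rule smooth_on_local[OF pencil_open[OF p]])
    fix u assume "u \<in> U"
    then obtain V where V: "openin (Euclidean_space n) V" "u \<in> V" "V \<subseteq> U" "smooth_on n V p"
      and alt: "p u \<noteq> 0 \<or> (\<exists>L\<in>lines. p ` V \<subseteq> L)"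
      using p unfolding pencil_def by metis
    from alt show "\<exists>V. openin (Euclidean_space n) V \<and> u \<in> V \<and> V \<subseteq> U \<and> smooth_on n V (\<lambda>u. bump_series d (p u))"
    proof
      assume nz: "p u \<noteq> 0"
      \<comment> \<open>On the part of V where the norm of p exceeds \<open>1 / 2 ^ N\<close> only the first N terms survive.\<close>
      obtain N :: nat where "1 / norm (p u) < 2 ^ N" using real_arch_pow[of 2] by auto
      then have N: "1 < 2 ^ N * norm (p u)" using nz by (simp add: field_simps)
      define W where "W = {w \<in> topspace (subtopology (Euclidean_space n) V). p w \<in> {x. 1 < 2 ^ N * norm x}}"
      have "openin (subtopology (Euclidean_space n) V) W"
        unfolding W_def
        by (rule openin_continuous_map_preimage[OF smooth_on_continuous_map[OF V(4)]])
           (simp, intro open_Collect_less continuous_intros)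
      then have W: "openin (Euclidean_space n) W" using V(1) openin_trans_full by blast
      have "smooth_on n W (\<lambda>u. bump_series d (p u))"
        by (rule smooth_on_bump_series_nonzero[OF W smooth_on_subset[OF V(4)], where N = N])
           (auto simp: W_def poly)
      moreover have "u \<in> W" "W \<subseteq> V" using V N openin_subset[OF V(1)] by (auto simp: W_def)
      ultimately show ?thesis using W V(3) by blast
    next
      assume "\<exists>L\<in>lines. p ` V \<subseteq> L"
      then obtain L where L: "L \<in> lines" "p ` V \<subseteq> L" by blast
      obtain v where v: "v \<in> L" "v \<in> circle" using line_unit_vector[OF L(1)] by blast
      then have Lv: "L = span {v}" using line_eq_span[OF L(1)] by force
      have proj: "(p w \<bullet> v) *\<^sub>R v = p w" if w: "w \<in> V" for w
      proof -
        obtain t where "p w = t *\<^sub>R v" using L(2) Lv w by (auto simp: span_singleton)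
        then show ?thesis using v(2) by (simp add: dot_square_norm)
      qed
      have "smooth_on n V (\<lambda>w. bump_series d ((p w \<bullet> v) *\<^sub>R v))"
        using bound[OF v(2)] bump_series_smooth_on_lines(1)[of d v, OF odd v(2)]
        by (intro smooth_on_smooth1[OF V(1) smooth_on_bounded_linear[OF V(1,4) bounded_linear_inner_left]]) auto
      then have "smooth_on n V (\<lambda>w. bump_series d (p w))"
        by (rule smooth_on_cong[OF V(1)]) (simp add: proj)
      then show ?thesis using V by blast
    qed
  qed
qed (auto simp: pencil_open)

section \<open>Germs and the Zariski cotangent space\<close>

lemma D_nbhds_Int: "B \<in> D_nbhds X D x \<Longrightarrow> B' \<in> D_nbhds X D x \<Longrightarrow> B \<inter> B' \<in> D_nbhds X D x"
  by (auto simp: D_nbhds_def)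

lemma equiv_germ_rel: "equiv (local_functions X D x) (germ_rel X D x)"
proof (rule equivI)
  show "germ_rel X D x \<subseteq> local_functions X D x \<times> local_functions X D x"
    by (auto simp: germ_rel_def)
  show "refl_on (local_functions X D x) (germ_rel X D x)"
    by (rule refl_onI) (auto simp: germ_rel_def local_functions_def)
  show "sym (germ_rel X D x)"
  proof (rule symI)
    fix a b assume "(a, b) \<in> germ_rel X D x"
    then obtain W where "W \<in> D_nbhds X D x" "W \<subseteq> fst a \<inter> fst b" "\<forall>y\<in>W. snd a y = snd b y"
      and "a \<in> local_functions X D x" "b \<in> local_functions X D x"
      by (auto simp: germ_rel_def)
    then show "(b, a) \<in> germ_rel X D x"
      by (auto simp: germ_rel_def intro!: bexI[of _ W])
  qed
  show "trans (germ_rel X D x)"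
  proof (rule transI)
    fix a b c assume "(a, b) \<in> germ_rel X D x" "(b, c) \<in> germ_rel X D x"
    then obtain W W' where W: "W \<in> D_nbhds X D x" "W \<subseteq> fst a \<inter> fst b" "\<forall>y\<in>W. snd a y = snd b y"
      and W': "W' \<in> D_nbhds X D x" "W' \<subseteq> fst b \<inter> fst c" "\<forall>y\<in>W'. snd b y = snd c y"
      and "a \<in> local_functions X D x" "c \<in> local_functions X D x"
      by (auto simp: germ_rel_def)
    then show "(a, c) \<in> germ_rel X D x"
      using D_nbhds_Int[OF W(1) W'(1)]
      by (auto simp: germ_rel_def intro!: bexI[of _ "W \<inter> W'"])
  qed
qed

lemma germ_of_eq_class:
  assumes "(B, f) \<in> local_functions X D x"
  shows "germ_of X D x B f = germ_rel X D x `` {(B, f)}"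
proof -
  have "restrict f B = f" using assms by (auto simp: local_functions_def smooth_functions_def extensional_restrict)
  then show ?thesis by (simp add: germ_of_def)
qed

lemma germ_of_in_carrier:
  "(B, f) \<in> local_functions X D x \<Longrightarrow> germ_of X D x B f \<in> carrier (germ_ring X D x)"
  by (simp add: germ_of_eq_class germ_ring_def quotientI)

lemma germ_of_self: "(B, f) \<in> local_functions X D x \<Longrightarrow> (B, f) \<in> germ_of X D x B f"
  by (subst germ_of_eq_class) (assumption, rule equiv_class_self[OF equiv_germ_rel])

lemma germ_member:
  assumes "a \<in> carrier (germ_ring X D x)" "(B, f) \<in> a"
  shows "(B, f) \<in> local_functions X D x" "a = germ_of X D x B f"
proof -
  have a: "a \<in> local_functions X D x // germ_rel X D x" using assms(1) by (simp add: germ_ring_def)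
  show *: "(B, f) \<in> local_functions X D x"
    using in_quotient_imp_subset[OF equiv_germ_rel a] assms(2) by blast
  show "a = germ_of X D x B f"
    unfolding germ_of_eq_class[OF *]
    using quotient_eq_iff[OF equiv_germ_rel a quotientI[OF *] assms(2) equiv_class_self[OF equiv_germ_rel *]]
      * equiv_class_self[OF equiv_germ_rel *] by simp
qed

lemma germ_nonempty:
  assumes "a \<in> carrier (germ_ring X D x)"
  obtains B f where "(B, f) \<in> a"
proof -
  have "a \<in> local_functions X D x // germ_rel X D x" using assms by (simp add: germ_ring_def)
  from in_quotient_imp_non_empty[OF equiv_germ_rel this] have "a \<noteq> {}" .
  then show ?thesis using that by fast
qed

lemma germ_members_agree:
  assumes "(C, k) \<in> germ_of X D x B f" "(B, f) \<in> local_functions X D x"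
  obtains W where "W \<in> D_nbhds X D x" "W \<subseteq> B \<inter> C" "\<And>y. y \<in> W \<Longrightarrow> f y = k y"
  using assms by (auto simp: germ_of_eq_class germ_rel_def)

lemma germ_of_eqI:
  assumes "(B, f) \<in> local_functions X D x" "(C, k) \<in> local_functions X D x"
    and "W \<in> D_nbhds X D x" "W \<subseteq> B \<inter> C" "\<And>y. y \<in> W \<Longrightarrow> f y = k y"
  shows "germ_of X D x B f = germ_of X D x C k"
proof -
  have "((B, f), (C, k)) \<in> germ_rel X D x" using assms by (auto simp: germ_rel_def)
  then show ?thesis
    by (simp add: germ_of_eq_class assms(1,2) equiv_class_eq[OF equiv_germ_rel])
qed

lemma germ_of_restrict [simp]: "germ_of X D x B (restrict f B) = germ_of X D x B f"
  by (simp add: germ_of_def)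

lemma germ_value_germ_of:
  assumes "(B, f) \<in> local_functions X D x"
  shows "germ_value x (germ_of X D x B f) = f x"
proof -
  have value_eq: "k x = f x" if k: "(C, k) \<in> germ_of X D x B f" for C k
  proof -
    obtain W where "W \<in> D_nbhds X D x" "W \<subseteq> B \<inter> C" "\<And>y. y \<in> W \<Longrightarrow> f y = k y"
      by (rule germ_members_agree[OF k assms]) auto
    then show ?thesis by (simp add: D_nbhds_def)
  qed
  have "(\<lambda>(B, f). f x) ` germ_of X D x B f = {f x}"
  proof (intro equalityI subsetI)
    show "y \<in> {f x}" if "y \<in> (\<lambda>(B, f). f x) ` germ_of X D x B f" for y
      using that value_eq by auto
    show "y \<in> (\<lambda>(B, f). f x) ` germ_of X D x B f" if "y \<in> {f x}" for y
      using that by (intro image_eqI[OF _ germ_of_self[OF assms]]) simp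
  qed
  then show ?thesis by (simp add: germ_value_def)
qed

lemma germ_of_in_germ_ideal:
  "(B, f) \<in> local_functions X D x \<Longrightarrow> f x = 0 \<Longrightarrow> germ_of X D x B f \<in> germ_ideal X D x"
  by (simp add: germ_ideal_def germ_of_in_carrier germ_value_germ_of)

lemma germ_idealE:
  assumes "a \<in> germ_ideal X D x"
  obtains B f where "(B, f) \<in> local_functions X D x" "f x = 0" "a = germ_of X D x B f"
proof -
  have a: "a \<in> carrier (germ_ring X D x)" "germ_value x a = 0" using assms by (auto simp: germ_ideal_def)
  obtain B f where Bf: "(B, f) \<in> a" using germ_nonempty[OF a(1)] .
  show ?thesis
    using that[OF germ_member(1)[OF a(1) Bf] _ germ_member(2)[OF a(1) Bf]] a(2)
      germ_value_germ_of[OF germ_member(1)[OF a(1) Bf]] germ_member(2)[OF a(1) Bf] by simp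
qed

context
  fixes X :: "'a set" and D :: "'a plots" and x :: 'a
  assumes plot_open: "\<forall>n U p. D n U p \<longrightarrow> openin (Euclidean_space n) U"
begin

lemma local_functions_combine:
  assumes f: "(B, f) \<in> local_functions X D x" and g: "(B', g) \<in> local_functions X D x"
    and h: "h = (+) \<or> h = (*)"
  shows "(B \<inter> B', restrict (\<lambda>y. h (f y) (g y)) (B \<inter> B')) \<in> local_functions X D x"
proof -
  have "restrict (\<lambda>y. h (f y) (g y)) (B \<inter> B') \<in> smooth_functions D (B \<inter> B')"
  proof (rule smooth_functionsI)
    fix n U p assume p: "D n U p" "p ` U \<subseteq> B \<inter> B'"
    have U: "openin (Euclidean_space n) U" using plot_open p(1) by blast
    have "smooth_on n U (\<lambda>u. f (p u))" "smooth_on n U (\<lambda>u. g (p u))"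
      using f g p by (auto simp: local_functions_def intro: smooth_functionsD)
    then have "smooth_on n U (\<lambda>u. h (f (p u)) (g (p u)))"
      using h smooth_on_add[OF U] smooth_on_mult[OF U] by auto
    then show "smooth_on n U (\<lambda>u. restrict (\<lambda>y. h (f y) (g y)) (B \<inter> B') (p u))"
      by (rule smooth_on_cong[OF U]) (use p(2) in auto)
  qed (use plot_open in auto)
  then show ?thesis using f g D_nbhds_Int by (auto simp: local_functions_def)
qed

text \<open>
  The combined germ does not depend on the representatives, so that the set of candidates in the
  definition of the operation is a singleton.
\<close>

lemma germ_op_eq:
  assumes a: "a \<in> carrier (germ_ring X D x)" "(B, f) \<in> a" and b: "b \<in> carrier (germ_ring X D x)" "(B', g) \<in> b"
    and h: "h = (+) \<or> h = (*)"
  shows "germ_op X D x h a b = germ_of X D x (B \<inter> B') (\<lambda>y. h (f y) (g y))"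
proof -
  have "germ_of X D x (C \<inter> C') (\<lambda>y. h (k y) (l y)) = germ_of X D x (B \<inter> B') (\<lambda>y. h (f y) (g y))"
    if k: "(C, k) \<in> a" and l: "(C', l) \<in> b" for C k C' l
  proof -
    note loc = germ_member(1)[OF a] germ_member(1)[OF b] germ_member(1)[OF a(1) k] germ_member(1)[OF b(1) l]
    obtain W where W: "W \<in> D_nbhds X D x" "W \<subseteq> B \<inter> C" "\<And>y. y \<in> W \<Longrightarrow> f y = k y"
      using germ_members_agree[OF _ loc(1), of C k] k germ_member(2)[OF a] by blast
    obtain W' where W': "W' \<in> D_nbhds X D x" "W' \<subseteq> B' \<inter> C'" "\<And>y. y \<in> W' \<Longrightarrow> g y = l y"
      using germ_members_agree[OF _ loc(2), of C' l] l germ_member(2)[OF b] by blast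
    have "germ_of X D x (C \<inter> C') (restrict (\<lambda>y. h (k y) (l y)) (C \<inter> C')) =
      germ_of X D x (B \<inter> B') (restrict (\<lambda>y. h (f y) (g y)) (B \<inter> B'))"
      by (rule germ_of_eqI[OF local_functions_combine[OF loc(3,4) h] local_functions_combine[OF loc(1,2) h]
            D_nbhds_Int[OF W(1) W'(1)]]) (use W W' in auto)
    then show ?thesis by simp
  qed
  then have "{germ_of X D x (B \<inter> B') (\<lambda>y. h (f y) (g y)) |B f B' g. (B, f) \<in> a \<and> (B', g) \<in> b} =
    {germ_of X D x (B \<inter> B') (\<lambda>y. h (f y) (g y))}"
    using a(2) b(2) by blast
  then show ?thesis by (simp only: germ_op_def the_elem_eq)
qed

lemma germ_op_in_carrier:
  assumes "a \<in> carrier (germ_ring X D x)" "b \<in> carrier (germ_ring X D x)" "h = (+) \<or> h = (*)"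
  shows "germ_op X D x h a b \<in> carrier (germ_ring X D x)"
proof -
  obtain B f B' g where f: "(B, f) \<in> a" and g: "(B', g) \<in> b"
    using germ_nonempty assms by metis
  show ?thesis
    using germ_of_in_carrier[OF local_functions_combine[OF germ_member(1)[OF assms(1) f]
          germ_member(1)[OF assms(2) g] assms(3)]]
    by (simp add: germ_op_eq[OF assms(1) f assms(2) g assms(3)])
qed

lemma germ_op_member_near:
  assumes a: "a \<in> carrier (germ_ring X D x)" "(B, f) \<in> a" and b: "b \<in> carrier (germ_ring X D x)" "(B', g) \<in> b"
    and h: "h = (+) \<or> h = (*)" and "(C, k) \<in> germ_op X D x h a b"
  obtains W where "W \<in> D_nbhds X D x" "\<And>y. y \<in> W \<Longrightarrow> k y = h (f y) (g y)"
proof -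
  have "(C, k) \<in> germ_of X D x (B \<inter> B') (restrict (\<lambda>y. h (f y) (g y)) (B \<inter> B'))"
    using assms(6) by (simp add: germ_op_eq[OF a b h])
  from germ_members_agree[OF this local_functions_combine[OF germ_member(1)[OF a] germ_member(1)[OF b] h]]
  obtain W where W: "W \<in> D_nbhds X D x" "W \<subseteq> (B \<inter> B') \<inter> C"
    "\<And>y. y \<in> W \<Longrightarrow> restrict (\<lambda>y. h (f y) (g y)) (B \<inter> B') y = k y" by blast
  show ?thesis
    using W(2) W(3)[symmetric] by (intro that[OF W(1)]) auto
qed

end

section \<open>The linewise derivative of a cotangent vector\<close>

lemma pencil_plots_open: "\<forall>n U p. pencil n U p \<longrightarrow> openin (Euclidean_space n) U"
  by (simp add: pencil_open)

lemma has_real_derivative_on_line_cong: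
  assumes W: "W \<in> D_nbhds UNIV pencil 0" and eq: "\<And>y. y \<in> W \<Longrightarrow> f y = g y" and v: "v \<in> circle"
    and d: "((\<lambda>t. f (t *\<^sub>R v)) has_real_derivative d) (at 0)"
  shows "((\<lambda>t. g (t *\<^sub>R v)) has_real_derivative d) (at 0)"
proof (rule has_field_derivative_transform_within_open[OF d])
  show "open {t. t *\<^sub>R v \<in> W}"
    using W v by (intro open_pencil_line) (auto simp: D_nbhds_def)
qed (use W eq in \<open>auto simp: D_nbhds_def\<close>)

lemma local_function_directional_derivative:
  assumes "(B, F) \<in> local_functions UNIV pencil 0" "v \<in> circle"
  obtains d where "((\<lambda>t. F (t *\<^sub>R v)) has_real_derivative d) (at 0)"
proof -
  have B: "openin (D_topology UNIV pencil) B" "0 \<in> B" and F: "F \<in> smooth_functions pencil B"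
    using assms(1) by (auto simp: local_functions_def D_nbhds_def)
  have "v \<noteq> 0" using assms(2) by auto
  from pencil_smooth_line[OF B(1) F this] show ?thesis
    by cases (use B(2) that in force)
qed

text \<open>
  The parametrization \<open>t *\<^sub>R v\<close> of the line and its inverse, the inner product with v, translate
  between derivatives of the one-variable function and derivatives within the line.  The Frechet
  derivative within the line is an arbitrary choice off the line, so it is evaluated on the line only.
\<close>

lemma line_deriv_eq:
  assumes v: "v \<in> circle" and d: "((\<lambda>t. F (t *\<^sub>R v)) has_real_derivative d) (at 0)"
  shows "line_deriv F (span {v}) = (\<lambda>w\<in>span {v}. (w \<bullet> v) * d)"
proof -
  let ?L = "span {v}"
  have vv: "v \<bullet> v = 1" using v by (simp add: dot_square_norm)
  have proj: "(w \<bullet> v) *\<^sub>R v = w" if "w \<in> ?L" for w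
    using that vv by (auto simp: span_singleton)
  have d': "((\<lambda>t. F (t *\<^sub>R v)) has_derivative (\<lambda>t. t * d)) (at 0)"
    using d by (simp add: has_field_derivative_def mult_commute_abs)
  then have "((\<lambda>t. F (t *\<^sub>R v)) has_derivative (\<lambda>t. t * d)) (at (0 \<bullet> v))" by simp
  moreover have "((\<lambda>w. w \<bullet> v) has_derivative (\<lambda>w. w \<bullet> v)) (at 0 within ?L)"
    by (intro bounded_linear.has_derivative[OF bounded_linear_inner_left] has_derivative_ident)
  ultimately have "((\<lambda>w. F ((w \<bullet> v) *\<^sub>R v)) has_derivative (\<lambda>w. (w \<bullet> v) * d)) (at 0 within ?L)"
    using has_derivative_compose by blast
  then have "(F has_derivative (\<lambda>w. (w \<bullet> v) * d)) (at 0 within ?L)"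
    by (rule has_derivative_transform[rotated 2]) (simp_all add: proj span_zero)
  then have "F differentiable (at 0 within ?L)" by (auto simp: differentiable_def)
  then have fd: "(F has_derivative frechet_derivative F (at 0 within ?L)) (at 0 within ?L)"
    by (simp add: frechet_derivative_works)
  define \<phi> where "\<phi> = frechet_derivative F (at 0 within ?L)"
  have lin: "linear \<phi>" using fd has_derivative_linear by (simp add: \<phi>_def) 
  have "(F has_derivative \<phi>) (at (0 *\<^sub>R v) within range (\<lambda>t. t *\<^sub>R v))"
    using fd by (simp add: \<phi>_def span_singleton)
  moreover have "((\<lambda>t. t *\<^sub>R v) has_derivative (\<lambda>t. t *\<^sub>R v)) (at 0)"
    by (auto intro!: derivative_eq_intros)
  ultimately have "((\<lambda>t. F (t *\<^sub>R v)) has_derivative (\<lambda>t. \<phi> (t *\<^sub>R v))) (at 0)"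
    using has_derivative_in_compose by blast
  then have "(\<lambda>t. \<phi> (t *\<^sub>R v)) = (\<lambda>t. t * d)"
    by (rule has_derivative_unique[OF _ d'])
  then have "\<phi> (t *\<^sub>R v) = t * d" for t by metis
  then have "\<phi> w = (w \<bullet> v) * d" if "w \<in> ?L" for w using proj[OF that] by metis
  then show ?thesis by (auto simp: line_deriv_def \<phi>_def)
qed

text \<open>
  The Leibniz rule: both factors of a product vanish at 0.
\<close>

lemma germ_ideal_sq_derivative_0:
  assumes "s \<in> germ_ideal_sq UNIV pencil 0"
  shows "s \<in> carrier (germ_ring UNIV pencil 0) \<and>
    (\<forall>C k v. (C, k) \<in> s \<and> v \<in> circle \<longrightarrow> ((\<lambda>t. k (t *\<^sub>R v)) has_real_derivative 0) (at 0))"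
  using assms unfolding germ_ideal_sq_def
proof (induction rule: ideal_prod.induct)
  case (prod i j)
  let ?R = "germ_ring UNIV pencil (0 :: real^2)"
  obtain B f where f: "(B, f) \<in> local_functions UNIV pencil 0" "f 0 = 0" "i = germ_of UNIV pencil 0 B f"
    by (rule germ_idealE[OF prod.hyps(1)])
  obtain B' g where g: "(B', g) \<in> local_functions UNIV pencil 0" "g 0 = 0" "j = germ_of UNIV pencil 0 B' g"
    by (rule germ_idealE[OF prod.hyps(2)])
  have i: "i \<in> carrier ?R" "(B, f) \<in> i" and j: "j \<in> carrier ?R" "(B', g) \<in> j"
    using f g germ_of_in_carrier germ_of_self by auto
  have mult: "i \<otimes>\<^bsub>?R\<^esub> j = germ_op UNIV pencil 0 (*) i j" by (simp add: germ_ring_def)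
  have "((\<lambda>t. k (t *\<^sub>R v)) has_real_derivative 0) (at 0)"
    if k: "(C, k) \<in> germ_op UNIV pencil 0 (*) i j" and v: "v \<in> circle" for C k v
  proof -
    obtain W where W: "W \<in> D_nbhds UNIV pencil 0" "\<And>y. y \<in> W \<Longrightarrow> k y = f y * g y"
      by (rule germ_op_member_near[OF pencil_plots_open i j _ k]) auto
    obtain d e where "((\<lambda>t. f (t *\<^sub>R v)) has_real_derivative d) (at 0)"
      "((\<lambda>t. g (t *\<^sub>R v)) has_real_derivative e) (at 0)"
      using local_function_directional_derivative[OF f(1) v] local_function_directional_derivative[OF g(1) v] by metis
    from DERIV_mult[OF this] have "((\<lambda>t. f (t *\<^sub>R v) * g (t *\<^sub>R v)) has_real_derivative 0) (at 0)"
      using f(2) g(2) by simp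
    then show ?thesis
      by (rule has_real_derivative_on_line_cong[OF W(1) _ v, of "\<lambda>y. f y * g y", rotated]) (simp add: W(2))
  qed
  then show ?case
    using germ_op_in_carrier[OF pencil_plots_open i(1) j(1), of "(*)"] unfolding mult by blast
next
  case (sum s1 s2)
  let ?R = "germ_ring UNIV pencil (0 :: real^2)"
  have s: "s1 \<in> carrier ?R" "s2 \<in> carrier ?R" using sum.IH by auto
  have add: "s1 \<oplus>\<^bsub>?R\<^esub> s2 = germ_op UNIV pencil 0 (+) s1 s2" by (simp add: germ_ring_def)
  obtain B f B' g where f: "(B, f) \<in> s1" and g: "(B', g) \<in> s2" using germ_nonempty s by metis
  have "((\<lambda>t. k (t *\<^sub>R v)) has_real_derivative 0) (at 0)"
    if k: "(C, k) \<in> germ_op UNIV pencil 0 (+) s1 s2" and v: "v \<in> circle" for C k v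
  proof -
    obtain W where W: "W \<in> D_nbhds UNIV pencil 0" "\<And>y. y \<in> W \<Longrightarrow> k y = f y + g y"
      by (rule germ_op_member_near[OF pencil_plots_open s(1) f s(2) g _ k]) auto
    have "((\<lambda>t. f (t *\<^sub>R v) + g (t *\<^sub>R v)) has_real_derivative 0 + 0) (at 0)"
      using sum.IH f g v by (intro DERIV_add) blast+
    then show ?thesis
      using has_real_derivative_on_line_cong[OF W(1) _ v, of "\<lambda>y. f y + g y" k 0] W(2) by simp
  qed
  then show ?case
    using germ_op_in_carrier[OF pencil_plots_open s, of "(+)"] unfolding add by blast
qed

text \<open>
  All representatives of the coset differ near 0 from F by a function with vanishing directional
  derivatives.
\<close>

lemma linewise_derivative_cot_class:
  assumes F: "(B, F) \<in> local_functions UNIV pencil 0" "F 0 = 0"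
  shows "linewise_derivative (cot_class UNIV pencil 0 (germ_of UNIV pencil 0 B F)) = (\<lambda>L\<in>lines. line_deriv F L)"
proof -
  let ?R = "germ_ring UNIV pencil (0 :: real^2)"
  define a where "a = germ_of UNIV pencil 0 B F"
  have a: "a \<in> carrier ?R" "(B, F) \<in> a" "a \<in> germ_ideal UNIV pencil 0"
    unfolding a_def by (rule germ_of_in_carrier germ_of_self germ_of_in_germ_ideal F)+
  have coset: "cot_class UNIV pencil 0 a = (\<lambda>s. germ_op UNIV pencil 0 (+) s a) ` germ_ideal_sq UNIV pencil 0"
    by (auto simp: cot_class_def a_r_coset_def' germ_ring_def)
  have eq: "line_deriv k L = line_deriv F L"
    if k: "(C, k) \<in> \<Union>(cot_class UNIV pencil 0 a)" and L: "L \<in> lines" for C k L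
  proof -
    obtain s where s: "s \<in> germ_ideal_sq UNIV pencil 0" and ks: "(C, k) \<in> germ_op UNIV pencil 0 (+) s a"
      using k by (auto simp: coset)
    note s0 = germ_ideal_sq_derivative_0[OF s]
    obtain B' f where f: "(B', f) \<in> s" by (rule germ_nonempty[OF s0[THEN conjunct1]])
    obtain W where W: "W \<in> D_nbhds UNIV pencil 0" "\<And>y. y \<in> W \<Longrightarrow> k y = f y + F y"
      by (rule germ_op_member_near[OF pencil_plots_open s0[THEN conjunct1] f a(1,2) _ ks]) auto
    obtain v where v: "v \<in> L" "v \<in> circle" using line_unit_vector[OF L] by blast
    then have Lv: "L = span {v}" using line_eq_span[OF L] by force
    obtain d where d: "((\<lambda>t. F (t *\<^sub>R v)) has_real_derivative d) (at 0)"
      using local_function_directional_derivative[OF F(1) v(2)] .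
    have "((\<lambda>t. f (t *\<^sub>R v) + F (t *\<^sub>R v)) has_real_derivative 0 + d) (at 0)"
      using s0 f v(2) by (intro DERIV_add d) blast
    then have "((\<lambda>t. k (t *\<^sub>R v)) has_real_derivative d) (at 0)"
      using has_real_derivative_on_line_cong[OF W(1) _ v(2), of "\<lambda>y. f y + F y" k d] W(2) by simp
    from line_deriv_eq[OF v(2) this] line_deriv_eq[OF v(2) d] show ?thesis by (simp only: Lv)
  qed
  \<comment> \<open>A representative exists: the square of the germ itself provides an element of the ideal.\<close>
  have "a \<otimes>\<^bsub>?R\<^esub> a \<in> germ_ideal_sq UNIV pencil 0"
    unfolding germ_ideal_sq_def by (rule ideal_prod.prod) (rule a(3))+
  then have "germ_op UNIV pencil 0 (+) (a \<otimes>\<^bsub>?R\<^esub> a) a \<in> cot_class UNIV pencil 0 a"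
    "germ_op UNIV pencil 0 (+) (a \<otimes>\<^bsub>?R\<^esub> a) a \<in> carrier ?R"
    using germ_op_in_carrier[OF pencil_plots_open _ a(1)] germ_ideal_sq_derivative_0 by (auto simp: coset)
  then obtain C k where rep: "(C, k) \<in> \<Union>(cot_class UNIV pencil 0 a)" by (meson germ_nonempty UnionI)
  have eq': "(\<lambda>L\<in>lines. line_deriv k L) = (\<lambda>L\<in>lines. line_deriv F L)"
    if "(C, k) \<in> \<Union>(cot_class UNIV pencil 0 a)" for C k
    by (rule restrict_ext) (rule eq[OF that])
  have "(\<lambda>(B, F). \<lambda>L\<in>lines. line_deriv F L) ` \<Union>(cot_class UNIV pencil 0 a) = {\<lambda>L\<in>lines. line_deriv F L}"
  proof (intro equalityI subsetI)
    fix y assume "y \<in> (\<lambda>(B, F). \<lambda>L\<in>lines. line_deriv F L) ` \<Union>(cot_class UNIV pencil 0 a)"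
    then obtain b where b: "b \<in> \<Union>(cot_class UNIV pencil 0 a)"
      and y: "y = (\<lambda>(B, F). \<lambda>L\<in>lines. line_deriv F L) b" by (rule imageE)
    show "y \<in> {\<lambda>L\<in>lines. line_deriv F L}"
      using eq'[of "fst b" "snd b"] b by (simp add: y case_prod_unfold)
  next
    fix y assume "y \<in> {\<lambda>L\<in>lines. line_deriv F L}"
    then show "y \<in> (\<lambda>(B, F). \<lambda>L\<in>lines. line_deriv F L) ` \<Union>(cot_class UNIV pencil 0 a)"
      using eq'[OF rep] by (intro image_eqI[OF _ rep]) simp
  qed
  then show ?thesis by (simp add: linewise_derivative_def a_def)
qed

lemma odd_of_linewise_derivative:
  assumes F: "(B, F) \<in> local_functions UNIV pencil 0" "F 0 = 0" and v: "v \<in> circle"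
    and d: "((\<lambda>t. F (t *\<^sub>R v)) has_real_derivative d) (at 0)"
  shows "odd_of_family (linewise_derivative (cot_class UNIV pencil 0 (germ_of UNIV pencil 0 B F))) v = d"
proof -
  have "v \<noteq> 0" "v \<bullet> v = 1" using v by (auto simp: dot_square_norm)
  then show ?thesis
    using v by (simp add: odd_of_family_def linewise_derivative_cot_class[OF F] span_in_lines
        line_deriv_eq[OF v d] span_base)
qed

theorem theorem4p2:
  shows "(\<forall>B F. (B, F) \<in> local_functions UNIV pencil 0 \<and> F 0 = 0 \<longrightarrow>
            (\<forall>v\<in>circle. ((\<lambda>t. F (t *\<^sub>R v)) has_real_derivative
               odd_of_family (linewise_derivative
                 (cot_class UNIV pencil 0 (germ_of UNIV pencil 0 B F))) v) (at 0))) \<and>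
         odd_of_family ` linewise_derivative ` E\<^sub>0_pencil = Odd_sigma"
proof
  have deriv: "((\<lambda>t. F (t *\<^sub>R v)) has_real_derivative
      odd_of_family (linewise_derivative (cot_class UNIV pencil 0 (germ_of UNIV pencil 0 B F))) v) (at 0)"
    if "(B, F) \<in> local_functions UNIV pencil 0" "F 0 = 0" "v \<in> circle" for B F v
    using local_function_directional_derivative[OF that(1,3)] odd_of_linewise_derivative[OF that] by metis
  then show "\<forall>B F. (B, F) \<in> local_functions UNIV pencil 0 \<and> F 0 = 0 \<longrightarrow>
      (\<forall>v\<in>circle. ((\<lambda>t. F (t *\<^sub>R v)) has_real_derivative
         odd_of_family (linewise_derivative (cot_class UNIV pencil 0 (germ_of UNIV pencil 0 B F))) v) (at 0))"
    by blast
  show "odd_of_family ` linewise_derivative ` E\<^sub>0_pencil = Odd_sigma"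
  proof
    show "odd_of_family ` linewise_derivative ` E\<^sub>0_pencil \<subseteq> Odd_sigma"
    proof
      fix h assume "h \<in> odd_of_family ` linewise_derivative ` E\<^sub>0_pencil"
      then obtain a where ideal: "a \<in> germ_ideal UNIV pencil 0"
        and h: "h = odd_of_family (linewise_derivative (cot_class UNIV pencil 0 a))"
        by (auto simp: cotangent_space_def)
      obtain B F where F: "(B, F) \<in> local_functions UNIV pencil 0" "F 0 = 0"
        and a: "a = germ_of UNIV pencil 0 B F" by (rule germ_idealE[OF ideal])
      have h': "((\<lambda>t. F (t *\<^sub>R v)) has_real_derivative h v) (at 0)" if "v \<in> circle" for v
        using deriv[OF F that] by (simp add: h a)
      have "h (- v) = - h v" if v: "v \<in> circle" for v
      proof -
        have "((\<lambda>t. F (- t *\<^sub>R v)) has_real_derivative h v * (- 1)) (at 0)"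
          by (rule DERIV_chain2[of "\<lambda>t. F (t *\<^sub>R v)"]) (auto simp: h'[OF v] intro!: derivative_eq_intros)
        moreover have "((\<lambda>t. F (- t *\<^sub>R v)) has_real_derivative h (- v)) (at 0)"
          using h'[of "- v"] v by simp
        ultimately show ?thesis using DERIV_unique by fastforce
      qed
      moreover have "h \<in> extensional circle" by (simp add: h odd_of_family_def)
      moreover have "sigma_continuous h"
        using F by (intro sigma_continuous_directional_derivative[of B F] h')
          (auto simp: local_functions_def D_nbhds_def)
      ultimately show "h \<in> Odd_sigma" by (simp add: Odd_sigma_def Odd_def)
    qed
    show "Odd_sigma \<subseteq> odd_of_family ` linewise_derivative ` E\<^sub>0_pencil"
    proof
      fix h assume "h \<in> Odd_sigma"
      then have h: "h \<in> Odd" "sigma_continuous h" by (auto simp: Odd_sigma_def)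
      obtain d :: "nat \<Rightarrow> real^2 \<Rightarrow> real" where poly: "\<And>n. real_polynomial_function (d n)"
        and odd: "\<And>n v. d n (- v) = - d n v"
        and sums: "\<And>v. v \<in> circle \<Longrightarrow> (\<lambda>n. d n v) sums h v"
        and bound: "\<And>v. v \<in> circle \<Longrightarrow> \<exists>N. \<forall>n\<ge>N. \<bar>d n v\<bar> \<le> 2 / fact n"
        using Odd_sigma_polynomial_series[OF h] by metis
      define F where "F = bump_series d"
      have "openin (D_topology UNIV pencil) UNIV"
        using openin_topspace[of "D_topology UNIV pencil"] topspace_D_topology[of pencil UNIV] pencil_open by auto
      then have F: "(UNIV, F) \<in> local_functions UNIV pencil 0"
        using bump_series_smooth_functions[OF poly odd bound]
        by (simp add: F_def local_functions_def D_nbhds_def)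
      have F0: "F 0 = 0" by (simp add: F_def bump_series_def bump_def)
      define g where "g = odd_of_family (linewise_derivative (cot_class UNIV pencil 0 (germ_of UNIV pencil 0 UNIV F)))"
      have "g = h"
      proof (rule extensionalityI[where A = circle])
        fix v assume v: "v \<in> circle"
        obtain N where "\<forall>n\<ge>N. \<bar>d n v\<bar> \<le> 2 / fact n" using bound[OF v] by blast
        from bump_series_smooth_on_lines(2)[of d v N, OF odd v this] show "g v = h v"
          unfolding g_def using sums_unique[OF sums[OF v]]
          by (intro odd_of_linewise_derivative[OF F F0 v]) (simp add: F_def)
      qed (use h in \<open>auto simp: g_def odd_of_family_def Odd_def\<close>)
      moreover have "g \<in> odd_of_family ` linewise_derivative ` E\<^sub>0_pencil"
        unfolding g_def cotangent_space_def by (intro imageI germ_of_in_germ_ideal F F0)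
      ultimately show "h \<in> odd_of_family ` linewise_derivative ` E\<^sub>0_pencil" by simp
    qed
  qed
qed

end
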